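(* Let $0<p,q<\infty$, let $\omega$ be an admissible weight on $\mathbb{D}$ (with respect to the exponent $p$), let $X=(X_n)_{n\ge0}$ be a standard random sequence, let $\{Q_j\}$ be a Whitney decomposition of $\mathbb{D}$, and let $f\in H(\mathbb{D})$. Then $\mathcal{R}_Xf\in A(p,q;\omega)$ almost surely if and only if $$\sum_j\left(\int_{Q_j}M_2(f,|z|)^p\,\omega(z)\,dA(z)\right)^{q/p}<\infty.$$
   Context: $\mathbb{D}$ is the open unit disk in $\mathbb{C}$, $H(\mathbb{D})$ the space of analytic functions on $\mathbb{D}$, and $dA=\frac1\pi r\,dr\,d\theta$ normalized area measure. A weight $\omega$ is a positive measurable function on $\mathbb{D}$ (not necessarily radial). $M_2(f,r)=\left(\int_0^{2\pi}|f(re^{i\theta})|^2\frac{d\theta}{2\pi}\right)^{1/2}$. Weighted Bergman space: $A^p_\omega$ is the set of $f\in H(\mathbb{D})$ with $\|f\|=\left(\int_{\mathbb{D}}|f|^p\omega\,dA\right)^{1/p}<\infty$. Admissible weight (with respect to $p$): (1) finite mass: $\int_{\mathbb{D}}\omega\,dA<\infty$; (2) bounded point evaluations: for every $z\in\mathbb{D}$ the functional $L_z(f)=f(z)$ is continuous on $A^p_\omega$, and $\sup_{z\in K}\|L_z\|<\infty$ for each compact $K\subset\mathbb{D}$; (3) $\lim_{r\to1^-}\|f_r-f\|=0$ for every $f\in A^p_\omega$, where $f_r(z)=f(rz)$. Standard random sequence: a sequence $(X_n)_{n\ge0}$ of independent identically distributed random variables, which are all Bernoulli ($\pm1$ with probability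 $1/2$ each), or all Steinhaus (uniform on the unit circle), or all Gaussian $\mathcal{N}(0,1)$. For $f(z)=\sum_{n\ge 0} a_nz^n\in H(\mathbb{D})$, $(\mathcal{R}_Xf)(z)=\sum_{n\ge 0} a_nX_nz^n$. Whitney decomposition of $\mathbb{D}$: a countable collection of "squares" $\{Q_j\}$ (measurable subsets of $\mathbb{D}$ whose boundaries have zero area, such as Euclidean squares or polar rectangles) with pairwise disjoint interiors such that: $\bigcup_j\overline{Q_j}=\mathbb{D}$; the hyperbolic diameters of the $Q_j$ are uniformly bounded; the Euclidean diameter satisfies $\operatorname{diam}(Q_j)\asymp\operatorname{dist}(Q_j,\partial\mathbb{D})$ with constants uniform in $j$; and, for some fixed inflation factor $\lambda>1$, each point of $\mathbb{D}$ lies in at most a uniformly bounded number of the inflated sets $\lambda Q_j$, where $\lambda Q=\{z:\operatorname{dist}(z,Q)\le(\lambda-1)\operatorname{diam}(Q)\}$. Weighted tent space: $T(p,q;\omega)$ is the set of measurable functions $g$ on $\mathbb{D}$ for which there exists a Whitney decomposition $\{Q_j\}$ of $\mathbb{D}$ with $\sum_j\left(\int_{Q_j}|g|^p\omega\,dA\right)^{q/p}<\infty$. Weighted analytic tent space: $A(p,q;\omega)=T(p,q;\omega)\cap H(\mathbb{D})$. *)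

theory Defs
  imports "HOL-Probability.Probability" "HOL-Complex_Analysis.Complex_Analysis"
begin

abbreviation unit_disk :: "complex set" where
  "unit_disk \<equiv> ball 0 1"

definition area :: "complex measure" where
  "area = scale_measure (ennreal (1 / pi)) (lebesgue_on unit_disk)"

text \<open>Real powers on \<open>[0,\<infinity>]\<close>; only used with positive exponents, hence \<open>\<infinity>\<close> is sent to \<open>\<infinity>\<close>.\<close>

definition ennreal_powr :: "ennreal \<Rightarrow> real \<Rightarrow> ennreal" where
  "ennreal_powr x r = (if x = \<infinity> then \<infinity> else ennreal (enn2real x powr r))"

definition weight :: "(complex \<Rightarrow> real) \<Rightarrow> bool" where
  "weight w \<longleftrightarrow> w \<in> borel_measurable (lebesgue_on unit_disk) \<and> (\<forall>z\<in>unit_disk. 0 < w z)"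


subsection \<open>Weighted Bergman spaces and admissible weights\<close>

text \<open>Functions on the disk are represented by functions on the complex plane, whose values
  outside the disk play no role. The (quasi-)norm takes values in \<open>[0,\<infinity>]\<close>.\<close>

definition bergman_norm :: "real \<Rightarrow> (complex \<Rightarrow> real) \<Rightarrow> (complex \<Rightarrow> complex) \<Rightarrow> ennreal" where
  "bergman_norm p w f =
     ennreal_powr (\<integral>\<^sup>+z. ennreal (cmod (f z) powr p * w z) \<partial>area) (1 / p)"

definition bergman_space :: "real \<Rightarrow> (complex \<Rightarrow> real) \<Rightarrow> (complex \<Rightarrow> complex) set" where
  "bergman_space p w = {f. f holomorphic_on unit_disk \<and> bergman_norm p w f < \<infinity>}"

text \<open>Continuity of \<open>f \<mapsto> f z\<close> with respect to the (quasi-)metric \<open>bergman_norm p w (g - f)\<close>.\<close>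

definition point_eval_continuous :: "real \<Rightarrow> (complex \<Rightarrow> real) \<Rightarrow> complex \<Rightarrow> bool" where
  "point_eval_continuous p w z \<longleftrightarrow>
     (\<forall>f\<in>bergman_space p w. \<forall>e>0. \<exists>d>0. \<forall>g\<in>bergman_space p w.
        bergman_norm p w (\<lambda>u. g u - f u) < ennreal d \<longrightarrow> cmod (g z - f z) < e)"

definition point_eval_norm :: "real \<Rightarrow> (complex \<Rightarrow> real) \<Rightarrow> complex \<Rightarrow> ennreal" where
  "point_eval_norm p w z =
     (SUP f\<in>{f\<in>bergman_space p w. bergman_norm p w f \<le> 1}. ennreal (cmod (f z)))"

definition admissible_weight :: "real \<Rightarrow> (complex \<Rightarrow> real) \<Rightarrow> bool" where
  "admissible_weight p w \<longleftrightarrow>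
     weight w \<and>
     (\<integral>\<^sup>+z. ennreal (w z) \<partial>area) < \<infinity> \<and>
     (\<forall>z\<in>unit_disk. point_eval_continuous p w z) \<and>
     (\<forall>K. compact K \<and> K \<subseteq> unit_disk \<longrightarrow> (SUP z\<in>K. point_eval_norm p w z) < \<infinity>) \<and>
     (\<forall>f\<in>bergman_space p w.
        ((\<lambda>r. bergman_norm p w (\<lambda>z. f (of_real r * z) - f z)) \<longlongrightarrow> 0) (at_left 1))"


subsection \<open>Random analytic functions\<close>

definition bernoulli_law :: "complex measure" where
  "bernoulli_law = distr (measure_pmf (pmf_of_set {1, -1})) borel (\<lambda>x. x)"

definition steinhaus_law :: "complex measure" where
  "steinhaus_law = distr (uniform_measure lborel {0..<2 * pi}) borel cis"

text \<open>The standard normal distribution on the real line, seen as a law on the complex plane.\<close>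

definition gaussian_law :: "complex measure" where
  "gaussian_law = distr (density lborel (\<lambda>t. ennreal (std_normal_density t))) borel complex_of_real"

definition standard_random_sequence :: "'a measure \<Rightarrow> (nat \<Rightarrow> 'a \<Rightarrow> complex) \<Rightarrow> bool" where
  "standard_random_sequence M X \<longleftrightarrow>
     prob_space M \<and> prob_space.indep_vars M (\<lambda>_. borel) X UNIV \<and>
     (\<exists>\<mu>\<in>{bernoulli_law, steinhaus_law, gaussian_law}. \<forall>n. distr M borel (X n) = \<mu>)"

definition taylor_coeff :: "(complex \<Rightarrow> complex) \<Rightarrow> nat \<Rightarrow> complex" where
  "taylor_coeff f n = (deriv ^^ n) f 0 / fact n"

text \<open>\<open>x\<close> is one realisation of the random sequence. For a standard random sequence the series
  converges on the whole disk almost surely, so the value of \<open>suminf\<close> on divergent series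
  does not affect almost sure statements.\<close>

definition randomize :: "(nat \<Rightarrow> complex) \<Rightarrow> (complex \<Rightarrow> complex) \<Rightarrow> complex \<Rightarrow> complex" where
  "randomize x f z = (\<Sum>n. taylor_coeff f n * x n * z ^ n)"

definition M2 :: "(complex \<Rightarrow> complex) \<Rightarrow> real \<Rightarrow> real" where
  "M2 f r = sqrt (integral {0..2 * pi} (\<lambda>t. (cmod (f (of_real r * cis t)))\<^sup>2 / (2 * pi)))"


subsection \<open>Whitney decompositions\<close>

text \<open>The normalisation of the hyperbolic metric is immaterial below.\<close>

definition hyp_dist :: "complex \<Rightarrow> complex \<Rightarrow> real" where
  "hyp_dist z u = artanh (cmod ((z - u) / (1 - cnj u * z)))"

definition hyp_diam :: "complex set \<Rightarrow> ennreal" where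
  "hyp_diam Q = (SUP z\<in>Q. SUP u\<in>Q. ennreal (hyp_dist z u))"

definition inflate :: "real \<Rightarrow> complex set \<Rightarrow> complex set" where
  "inflate l Q = {z. infdist z Q \<le> (l - 1) * diameter Q}"

text \<open>A ``square'' is any nonempty measurable subset of the disk with null boundary.\<close>

definition whitney_decomposition :: "complex set set \<Rightarrow> bool" where
  "whitney_decomposition W \<longleftrightarrow>
     countable W \<and>
     (\<forall>Q\<in>W. Q \<noteq> {} \<and> Q \<subseteq> unit_disk \<and> Q \<in> sets lebesgue \<and> frontier Q \<in> null_sets lebesgue) \<and>
     (\<forall>Q\<in>W. \<forall>R\<in>W. Q \<noteq> R \<longrightarrow> interior Q \<inter> interior R = {}) \<and>
     (\<Union>Q\<in>W. closure Q) = unit_disk \<and>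
     (\<exists>C::real. \<forall>Q\<in>W. hyp_diam Q \<le> ennreal C) \<and>
     (\<exists>c>0. \<exists>C>0. \<forall>Q\<in>W.
        c * setdist Q (sphere 0 1) \<le> diameter Q \<and> diameter Q \<le> C * setdist Q (sphere 0 1)) \<and>
     (\<exists>l>1. \<exists>N::nat. \<forall>z\<in>unit_disk.
        finite {Q\<in>W. z \<in> inflate l Q} \<and> card {Q\<in>W. z \<in> inflate l Q} \<le> N)"


subsection \<open>Tent spaces\<close>

definition tent_space :: "real \<Rightarrow> real \<Rightarrow> (complex \<Rightarrow> real) \<Rightarrow> (complex \<Rightarrow> complex) set" where
  "tent_space p q w =
     {g. g \<in> borel_measurable (lebesgue_on unit_disk) \<and>
         (\<exists>W. whitney_decomposition W \<and>
            (\<Sum>\<^sub>\<infinity>Q\<in>W. ennreal_powr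
               (\<integral>\<^sup>+z\<in>Q. ennreal (cmod (g z) powr p * w z) \<partial>area) (q / p)) < \<infinity>)}"

definition analytic_tent_space ::
  "real \<Rightarrow> real \<Rightarrow> (complex \<Rightarrow> real) \<Rightarrow> (complex \<Rightarrow> complex) set" where
  "analytic_tent_space p q w = tent_space p q w \<inter> {f. f holomorphic_on unit_disk}"

end

theory Submission
  imports Defs "HOL-Probability.Hoeffding"
begin

text \<open>Let \<open>V(z) = M\<^sub>2(f, |z|)\<close>, so that \<open>V(z)\<^sup>2 = \<Sum>|a\<^sub>n|\<^sup>2 |z|\<^sup>2\<^sup>n\<close> by Parseval. In all three
  cases \<open>X\<^sub>n\<close> is centred and normalised with \<open>E exp (Re (c X\<^sub>n)) \<le> exp (|c|\<^sup>2 / 2)\<close>; hence, for every \<open>z\<close>,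
  \<open>E |R f(z)|\<^sup>t \<le> C V(z)\<^sup>t\<close> for all \<open>t > 0\<close>, and by a Paley-Zygmund type argument
  \<open>E min (|R f(z)|\<^sup>p) (V(z)\<^sup>p) \<ge> \<kappa> V(z)\<^sup>p\<close>. Integrating over a square \<open>Q\<close> with Tonelli and Jensen shows that
  \<open>Y = (\<integral>\<^sub>Q |R f|\<^sup>p \<omega>)\<^sup>q\<^sup>/\<^sup>p\<close> and \<open>m = (\<integral>\<^sub>Q V\<^sup>p \<omega>)\<^sup>q\<^sup>/\<^sup>p\<close> satisfy \<open>E Y \<le> C m\<close> and \<open>E min Y m \<ge> c m\<close> with
  constants independent of \<open>Q\<close>. The first bound gives one implication. For the other one, \<open>\<Sum>Y\<close> is at most
  some \<open>B\<close> off an event of probability at most \<open>c / 2\<close>, and the second bound yields \<open>c / 2 * \<Sum>m \<le> B\<close>.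
  Since a square of one Whitney decomposition meets boundedly many squares of another one, it does not
  matter that the decomposition in the definition of the tent space may depend on the random function.\<close>

subsection \<open>Extended powers and sums\<close>

lemma ennreal_powr_ennreal [simp]: "0 \<le> a \<Longrightarrow> ennreal_powr (ennreal a) r = ennreal (a powr r)"
  by (simp add: ennreal_powr_def)

lemma ennreal_powr_top [simp]: "ennreal_powr \<top> r = \<top>"
  by (simp add: ennreal_powr_def)

lemma ennreal_powr_0 [simp]: "ennreal_powr 0 r = 0"
  by (simp add: ennreal_powr_def)

lemma ennreal_powr_mono:
  assumes "x \<le> y" "0 < r"
  shows "ennreal_powr x r \<le> ennreal_powr y r"
proof (cases y)
  case (real b)
  then obtain a where "x = ennreal a" "0 \<le> a"
    using assms(1) by (cases x) (auto simp: top_unique)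
  then show ?thesis
    using real assms by (auto intro!: ennreal_leI powr_mono2)
qed simp

lemma ennreal_powr_mult_ennreal:
  assumes "0 < c"
  shows "ennreal_powr (ennreal c * x) r = ennreal (c powr r) * ennreal_powr x r"
proof (cases x)
  case (real b)
  then show ?thesis
    using assms by (simp add: powr_mult flip: ennreal_mult)
next
  case top
  then show ?thesis
    using assms by (simp add: ennreal_mult_top)
qed

lemma measurable_ennreal_powr [measurable (raw)]:
  assumes [measurable]: "f \<in> borel_measurable M"
  shows "(\<lambda>x. ennreal_powr (f x) r) \<in> borel_measurable M"
  unfolding ennreal_powr_def by measurable

text \<open>The sum is at most K times its largest term. This argument covers all r > 0 at once,
  without separating the concave case r <= 1 from the convex one.\<close>

lemma ennreal_powr_sum_le:
  assumes "finite I" "card I \<le> K" "0 < K" "0 < r"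
  shows "ennreal_powr (\<Sum>i\<in>I. x i) r \<le> ennreal (real K powr r) * (\<Sum>i\<in>I. ennreal_powr (x i) r)"
proof (cases "I = {}")
  case False
  define m where "m = Max (x ` I)"
  obtain j where j: "j \<in> I" "m = x j"
    using Max_in[of "x ` I"] assms(1) False unfolding m_def by blast
  have "(\<Sum>i\<in>I. x i) \<le> (\<Sum>i\<in>I. m)"
    by (rule sum_mono) (simp add: m_def assms(1))
  also have "\<dots> \<le> ennreal (real K) * m"
    using assms(2) by (simp add: ennreal_of_nat_eq_real_of_nat mult_right_mono)
  finally have "ennreal_powr (\<Sum>i\<in>I. x i) r \<le> ennreal_powr (ennreal (real K) * m) r"
    using assms by (intro ennreal_powr_mono) auto
  also have "\<dots> = ennreal (real K powr r) * ennreal_powr m r"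
    using assms by (subst ennreal_powr_mult_ennreal) auto
  also have "\<dots> \<le> ennreal (real K powr r) * (\<Sum>i\<in>I. ennreal_powr (x i) r)"
    unfolding j(2) using assms j by (intro mult_left_mono member_le_sum) auto
  finally show ?thesis .
qed simp

text \<open>Written as integrals, sums over a countable family of squares become accessible to
  Tonelli's theorem and to the measurability of parameter integrals.\<close>

lemma infsum_eq_nn_integral_count_space:
  fixes f :: "'a \<Rightarrow> ennreal"
  assumes "countable A"
  shows "infsum f A = (\<integral>\<^sup>+i. f i \<partial>count_space A)"
proof (cases "finite A")
  case True
  then show ?thesis by (simp add: nn_integral_count_space_finite)
next
  case False
  have bij: "bij_betw (from_nat_into A) UNIV A"
    using assms False by (simp add: bij_betw_from_nat_into)
  have "infsum f A = (\<Sum>\<^sub>\<infinity>n. f (from_nat_into A n))"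
    using infsum_reindex_bij_betw[OF bij, of f] by simp
  also have "\<dots> = (\<Sum>n. f (from_nat_into A n))"
    by (intro sums_unique has_sum_imp_sums has_sum_infsum nonneg_summable_on_complete) simp
  also have "\<dots> = (\<integral>\<^sup>+n. f (from_nat_into A n) \<partial>count_space UNIV)"
    by (simp add: nn_integral_count_space_nat)
  also have "\<dots> = (\<integral>\<^sup>+i. f i \<partial>count_space A)"
    using nn_integral_bij_count_space[OF bij] by simp
  finally show ?thesis .
qed

subsection \<open>Comparison of Whitney decompositions\<close>

text \<open>A finite net of the ball of radius R about 0 exists by compactness; translating and
  scaling it serves every centre x and every scale d, so the number of balls depends only on R and
  e.\<close>

lemma bounded_ball_net:
  fixes R e :: real
  assumes "0 < e"
  obtains F :: "complex set" where "finite F" "\<And>x d. 0 < d \<Longrightarrow> cball x (R * d) \<subseteq> (\<Union>y\<in>F. ball (x + of_real d * y) (e * d))"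
proof -
  have "compact (cball (0::complex) R)" by simp
  then obtain F where F: "finite F" "cball (0::complex) R \<subseteq> (\<Union>y\<in>F. ball y e)"
    by (rule compactE_image[where C="cball 0 R" and f="\<lambda>y. ball y e"]) (use assms in auto)
  have "cball x (R * d) \<subseteq> (\<Union>y\<in>F. ball (x + of_real d * y) (e * d))" if d: "0 < d" for x d
  proof
    fix z assume z: "z \<in> cball x (R * d)"
    have "(z - x) / of_real d \<in> cball 0 R"
      using z d by (simp add: norm_divide dist_norm norm_minus_commute field_simps)
    then obtain y where y: "y \<in> F" "cmod (y - (z - x) / of_real d) < e"
      using F by (auto simp: dist_norm)
    have "x + of_real d * y - z = of_real d * (y - (z - x) / of_real d)"
      using d by (simp add: field_simps)
    then have "cmod (x + of_real d * y - z) = d * cmod (y - (z - x) / of_real d)"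
      using d by (simp add: norm_mult)
    also have "\<dots> < e * d" using y d by simp
    finally show "z \<in> (\<Union>y\<in>F. ball (x + of_real d * y) (e * d))"
      using y by (auto simp: dist_norm)
  qed
  then show ?thesis using F that by blast
qed

section \<open>Distances from Whitney squares to the unit circle\<close>

lemma setdist_sphere_le:
  fixes z :: complex
  assumes "z \<in> Q" "cmod z \<le> 1"
  shows "setdist Q (sphere 0 1) \<le> 1 - cmod z"
proof -
  \<comment> \<open>The boundary point nearest to z is its radial projection; since
    \<open>sgn 0 = 0\<close>, the origin needs a choice of its own.\<close>
  define u where "u = (if z = 0 then 1 else sgn z)"
  have "cmod u = 1" by (simp add: u_def norm_sgn)
  moreover have "dist z u = 1 - cmod z"
  proof (cases "z = 0")
    case False
    have "z - u = - (of_real (1 - cmod z) * sgn z)"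
      using False by (simp add: u_def sgn_eq field_simps)
    then show ?thesis
      using False assms(2) by (simp add: dist_norm norm_mult norm_sgn flip: of_real_diff)
  qed (simp add: u_def)
  ultimately show ?thesis
    using setdist_le_dist[OF assms(1), of u "sphere 0 1"] by simp
qed

text \<open>With \<open>setdist_sphere_le\<close> this makes 1 - |z|, for z in a Whitney square,
  comparable to the distance of the whole square from the circle, because the diameter is controlled
  by that distance.\<close>

lemma le_setdist_sphere_diameter:
  fixes z :: complex
  assumes "z \<in> Q" "bounded Q"
  shows "1 - cmod z \<le> setdist Q (sphere 0 1) + diameter Q"
proof -
  have "1 - cmod z - diameter Q \<le> setdist Q (sphere 0 1)"
  proof (rule le_setdistI)
    fix x y assume xy: "x \<in> Q" "y \<in> sphere (0::complex) 1"
    have "1 \<le> cmod z + dist z x + dist x y"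
      using xy norm_triangle_ineq[of z "y - z"] dist_triangle[of z y x]
      by (simp add: dist_norm norm_minus_commute)
    moreover have "dist z x \<le> diameter Q"
      using assms xy by (intro diameter_bounded_bound) auto
    ultimately show "1 - cmod z - diameter Q \<le> dist x y" by simp
  qed (use assms in auto)
  then show ?thesis by simp
qed

lemma whitney_decomposition_subset:
  assumes "whitney_decomposition W" "Q \<in> W"
  shows "Q \<noteq> {}" "Q \<subseteq> unit_disk" "Q \<in> sets lebesgue" "frontier Q \<in> null_sets lebesgue"
proof -
  have "\<forall>Q\<in>W. Q \<noteq> {} \<and> Q \<subseteq> unit_disk \<and> Q \<in> sets lebesgue \<and> frontier Q \<in> null_sets lebesgue"
    using assms(1) unfolding whitney_decomposition_def by (elim conjE)
  with assms(2) show "Q \<noteq> {}" "Q \<subseteq> unit_disk" "Q \<in> sets lebesgue" "frontier Q \<in> null_sets lebesgue"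
    by blast+
qed

lemma whitney_decomposition_diameter:
  assumes "whitney_decomposition W"
  obtains c C where "0 < c" "0 < C"
    "\<And>Q. Q \<in> W \<Longrightarrow> c * setdist Q (sphere 0 1) \<le> diameter Q"
    "\<And>Q. Q \<in> W \<Longrightarrow> diameter Q \<le> C * setdist Q (sphere 0 1)"
proof -
  have "\<exists>c>0. \<exists>C>0. \<forall>Q\<in>W.
      c * setdist Q (sphere 0 1) \<le> diameter Q \<and> diameter Q \<le> C * setdist Q (sphere 0 1)"
    using assms unfolding whitney_decomposition_def by (elim conjE)
  then show ?thesis using that by blast
qed

text \<open>At distance 0 the diameter would be 0 too, and then a point of Q would have modulus at
  least 1. The positive distance later keeps \<open>M2\<close> bounded on Q.\<close>

lemma whitney_decomposition_setdist_pos: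
  assumes "whitney_decomposition W" "Q \<in> W"
  shows "0 < setdist Q (sphere 0 1)"
proof (rule ccontr)
  assume "\<not> ?thesis"
  then have 0: "setdist Q (sphere 0 1) = 0"
    using setdist_pos_le[of Q "sphere 0 1"] by simp
  have Q: "Q \<noteq> {}" "Q \<subseteq> unit_disk"
    using assms unfolding whitney_decomposition_def by auto
  obtain C where "diameter Q \<le> C * setdist Q (sphere 0 1)"
    using whitney_decomposition_diameter[OF assms(1)] assms(2) by metis
  with 0 have "diameter Q \<le> 0" by simp
  obtain z where z: "z \<in> Q" using Q by auto
  have "bounded Q" using Q bounded_subset bounded_ball by blast
  then have "1 - cmod z \<le> 0"
    using le_setdist_sphere_diameter[OF z] 0 \<open>diameter Q \<le> 0\<close> by simp
  then show False using z Q by auto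
qed

text \<open>A set of the first family which meets \<open>Q\<close> has diameter comparable to that of \<open>Q\<close>, so its
  inflation contains one of a bounded number of net points of \<open>Q\<close>.\<close>

lemma whitney_decomposition_overlap:
  assumes W1: "whitney_decomposition W1" and W2: "whitney_decomposition W2"
  obtains K :: nat where "0 < K"
    "\<And>Q. Q \<in> W2 \<Longrightarrow> finite {R\<in>W1. R \<inter> Q \<noteq> {}} \<and> card {R\<in>W1. R \<inter> Q \<noteq> {}} \<le> K"
proof -
  obtain c1 C1 where c1: "0 < c1" "0 < C1"
    "\<And>R. R \<in> W1 \<Longrightarrow> c1 * setdist R (sphere 0 1) \<le> diameter R"
    "\<And>R. R \<in> W1 \<Longrightarrow> diameter R \<le> C1 * setdist R (sphere 0 1)"
    using whitney_decomposition_diameter[OF W1] by metis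
  obtain C2 where C2: "\<And>Q. Q \<in> W2 \<Longrightarrow> diameter Q \<le> C2 * setdist Q (sphere 0 1)"
    using whitney_decomposition_diameter[OF W2] by metis
  have "\<exists>l>1. \<exists>N::nat. \<forall>z\<in>unit_disk.
      finite {R\<in>W1. z \<in> inflate l R} \<and> card {R\<in>W1. z \<in> inflate l R} \<le> N"
    using W1 unfolding whitney_decomposition_def by (elim conjE)
  then obtain l and N :: nat where lN: "1 < l"
    "\<And>z. z \<in> unit_disk \<Longrightarrow> finite {R\<in>W1. z \<in> inflate l R}"
    "\<And>z. z \<in> unit_disk \<Longrightarrow> card {R\<in>W1. z \<in> inflate l R} \<le> N"
    by blast
  have sub: "R \<subseteq> unit_disk" "bounded R" if "R \<in> W1 \<or> R \<in> W2" for R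
  proof -
    show "R \<subseteq> unit_disk"
      using that whitney_decomposition_subset[OF W1] whitney_decomposition_subset[OF W2] by blast
    then show "bounded R" using bounded_subset bounded_ball by blast
  qed
  \<comment> \<open>If R meets Q and d is the distance of Q from the circle, then d <= (1 + C1) *
    \<open>setdist R (sphere 0 1)\<close>, so R has diameter at least c1 * d / (1 + C1). Thus e * d
    is a lower bound for the width \<open>(l - 1) * diameter R\<close> of the inflation. The net
    uses radius e / 2 because two points of one ball are compared.\<close>
  define e where "e = (l - 1) * c1 / (1 + C1)"
  have e: "0 < e / 2" unfolding e_def using lN c1 by simp
  obtain F :: "complex set" where F: "finite F"
    "\<And>x d. 0 < d \<Longrightarrow> cball x (C2 * d) \<subseteq> (\<Union>y\<in>F. ball (x + of_real d * y) (e / 2 * d))"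
    using bounded_ball_net[OF e, of C2] by blast
  have main: "finite {R\<in>W1. R \<inter> Q \<noteq> {}} \<and> card {R\<in>W1. R \<inter> Q \<noteq> {}} \<le> card F * N + 1"
    if Q: "Q \<in> W2" for Q
  proof -
    define d where "d = setdist Q (sphere 0 1)"
    have d: "0 < d" unfolding d_def using whitney_decomposition_setdist_pos[OF W2 Q] .
    obtain x where x: "x \<in> Q"
      using whitney_decomposition_subset[OF W2 Q] by blast
    have Qsub: "Q \<subseteq> (\<Union>y\<in>F. ball (x + of_real d * y) (e / 2 * d))"
    proof -
      have "dist x u \<le> C2 * d" if "u \<in> Q" for u
        using C2[OF Q] diameter_bounded_bound[of Q x u] x sub(2)[of Q] Q that
        by (simp add: d_def)
      then have "Q \<subseteq> cball x (C2 * d)" by (intro subsetI) (simp only: mem_cball)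
      then show ?thesis using F(2)[OF d, of x] by (rule subset_trans)
    qed
    \<comment> \<open>The centres of the net may lie outside the disk, where the overlap bound says
      nothing. Each ball that meets Q is therefore represented by a point \<open>t y\<close> of
      Q.\<close>
    define B where "B y = Q \<inter> ball (x + of_real d * y) (e / 2 * d)" for y
    define G where "G = {y\<in>F. B y \<noteq> {}}"
    define t where "t y = (SOME u. u \<in> B y)" for y
    have t: "t y \<in> B y" if "y \<in> G" for y
      unfolding t_def using that someI_ex[of "\<lambda>u. u \<in> B y"] by (auto simp: G_def)
    have t_disk: "t y \<in> unit_disk" if "y \<in> G" for y
      using t[OF that] sub[of Q] Q by (auto simp: B_def)
    have cover: "{R\<in>W1. R \<inter> Q \<noteq> {}} \<subseteq> (\<Union>y\<in>G. {R\<in>W1. t y \<in> inflate l R})"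
    proof (rule subsetI)
      fix R assume "R \<in> {R\<in>W1. R \<inter> Q \<noteq> {}}"
      then obtain z where R: "R \<in> W1" and z: "z \<in> R" "z \<in> Q" by blast
      obtain y where y: "y \<in> F" "z \<in> B y" using Qsub z by (auto simp: B_def)
      then have yG: "y \<in> G" by (auto simp: G_def)
      have "dist (t y) z \<le> e * d"
      proof -
        have "dist (x + of_real d * y) (t y) < e / 2 * d" "dist (x + of_real d * y) z < e / 2 * d"
          using t[OF yG] y by (auto simp: B_def)
        then show ?thesis
          using dist_triangle2[of "t y" z "x + of_real d * y"] by (simp add: dist_commute)
      qed
      moreover have "infdist (t y) R \<le> dist (t y) z" using z by (rule_tac infdist_le)
      moreover have "e * d \<le> (l - 1) * diameter R"
      proof -
        have "d \<le> 1 - cmod z" unfolding d_def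
          using z sub[of Q] Q by (intro setdist_sphere_le) (auto simp: less_imp_le)
        also have "\<dots> \<le> setdist R (sphere 0 1) + diameter R"
          using z R sub[of R] by (intro le_setdist_sphere_diameter) auto
        also have "\<dots> \<le> (1 + C1) * setdist R (sphere 0 1)"
          using c1(4)[OF R] by (simp add: algebra_simps)
        finally have "d / (1 + C1) \<le> setdist R (sphere 0 1)"
          using c1 by (simp add: field_simps)
        then have "c1 * (d / (1 + C1)) \<le> diameter R"
          using c1(3)[OF R] c1(1) mult_left_mono[of "d / (1 + C1)" "setdist R (sphere 0 1)" c1]
          by linarith
        then have "(l - 1) * (c1 * (d / (1 + C1))) \<le> (l - 1) * diameter R"
          using lN by (intro mult_left_mono) auto
        then show ?thesis by (simp add: e_def mult.assoc)
      qed
      ultimately have "t y \<in> inflate l R" by (simp add: inflate_def)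
      then show "R \<in> (\<Union>y\<in>G. {R\<in>W1. t y \<in> inflate l R})" using yG R by blast
    qed
    have finG: "finite G" "card G \<le> card F"
      using F(1) by (auto simp: G_def intro!: card_mono)
    have fin: "finite (\<Union>y\<in>G. {R\<in>W1. t y \<in> inflate l R})"
      using finG lN(2) t_disk by blast
    have "card {R\<in>W1. R \<inter> Q \<noteq> {}} \<le> card (\<Union>y\<in>G. {R\<in>W1. t y \<in> inflate l R})"
      by (intro card_mono fin cover)
    also have "\<dots> \<le> (\<Sum>y\<in>G. card {R\<in>W1. t y \<in> inflate l R})"
      by (intro card_UN_le finG)
    also have "\<dots> \<le> (\<Sum>y\<in>G. N)"
      using lN(3) t_disk by (intro sum_mono) auto
    also have "\<dots> \<le> card F * N" using finG by simp
    finally show ?thesis using finite_subset[OF cover fin] by simp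
  qed
  \<comment> \<open>Adding 1 gives \<open>0 < K\<close> whatever the values of \<open>card F\<close>
    and N.\<close>
  show ?thesis by (rule that[of "card F * N + 1"]) (use main in auto)
qed

section \<open>Area measure, and comparison of the sums over two decompositions\<close>

lemma sets_area [measurable_cong]: "sets area = sets (lebesgue_on unit_disk)"
  and space_area [simp]: "space area = unit_disk"
  by (simp_all add: area_def space_scale_measure)

lemma AE_area: "(AE z in lebesgue. z \<in> unit_disk \<longrightarrow> P z) \<Longrightarrow> AE z in area. P z"
proof -
  assume "AE z in lebesgue. z \<in> unit_disk \<longrightarrow> P z"
  then have "AE z in lebesgue_on unit_disk. P z"
    by (subst AE_restrict_space_iff) auto
  then obtain N where "{z\<in>unit_disk. \<not> P z} \<subseteq> N" "N \<in> null_sets (lebesgue_on unit_disk)"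
    by (auto simp: eventually_ae_filter)
  then show ?thesis
    by (auto simp: eventually_ae_filter sets_area null_sets_def area_def space_scale_measure)
qed

lemma whitney_decomposition_measurable:
  assumes "whitney_decomposition W" "Q \<in> W"
  shows "Q \<in> sets area"
  using assms unfolding whitney_decomposition_def sets_area
  by (simp add: sets_restrict_space_iff)

text \<open>Only the closures are known to cover the disk. A point of a closure that misses the set
  lies on its frontier, and countably many null frontiers form a null set.\<close>

lemma whitney_decomposition_AE_cover:
  assumes W: "whitney_decomposition W"
  shows "AE z in area. \<exists>Q\<in>W. z \<in> Q"
proof (rule AE_area)
  have "(\<Union>Q\<in>W. frontier Q) \<in> null_sets lebesgue"
    using W whitney_decomposition_subset[OF W]
    unfolding whitney_decomposition_def by (intro null_sets_UN') auto
  moreover have "\<exists>Q\<in>W. z \<in> Q" if "z \<in> unit_disk" "z \<notin> (\<Union>Q\<in>W. frontier Q)" for z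
  proof -
    have "z \<in> (\<Union>Q\<in>W. closure Q)"
      using W that(1) unfolding whitney_decomposition_def by simp
    then obtain Q where "Q \<in> W" "z \<in> closure Q" by auto
    then show ?thesis
      using that(2) interior_subset[of Q] by (auto simp: frontier_def)
  qed
  ultimately show "AE z in lebesgue. z \<in> unit_disk \<longrightarrow> (\<exists>Q\<in>W. z \<in> Q)"
    by (auto elim!: AE_mp[OF AE_not_in])
qed

text \<open>The overlap bound is used in both directions: Q is covered, up to a null set, by at most
  K squares R, and in the double sum each R is counted for at most L squares Q. This removes the
  dependence of the tent space condition on the decomposition.\<close>

lemma whitney_sum_finite_transfer:
  assumes W1: "whitney_decomposition W1" and W2: "whitney_decomposition W2"
    and h [measurable]: "h \<in> borel_measurable (lebesgue_on unit_disk)" and s: "0 < s"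
    and fin: "(\<Sum>\<^sub>\<infinity>Q\<in>W1. ennreal_powr (\<integral>\<^sup>+z\<in>Q. h z \<partial>area) s) < \<infinity>"
  shows "(\<Sum>\<^sub>\<infinity>Q\<in>W2. ennreal_powr (\<integral>\<^sup>+z\<in>Q. h z \<partial>area) s) < \<infinity>"
proof -
  obtain K where K: "0 < K"
    "\<And>Q. Q \<in> W2 \<Longrightarrow> finite {R\<in>W1. R \<inter> Q \<noteq> {}} \<and> card {R\<in>W1. R \<inter> Q \<noteq> {}} \<le> K"
    using whitney_decomposition_overlap[OF W1 W2] by blast
  obtain L where L:
    "\<And>R. R \<in> W1 \<Longrightarrow> finite {Q\<in>W2. Q \<inter> R \<noteq> {}} \<and> card {Q\<in>W2. Q \<inter> R \<noteq> {}} \<le> L"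
    using whitney_decomposition_overlap[OF W2 W1] by blast
  have cnt: "countable W1" "countable W2"
    using W1 W2 unfolding whitney_decomposition_def by auto
  note [measurable] = whitney_decomposition_measurable[OF W1] whitney_decomposition_measurable[OF W2]
  have hm [measurable]: "h \<in> borel_measurable area"
    using h by (simp cong: measurable_cong_sets add: sets_area)
  define y where "y R = ennreal_powr (\<integral>\<^sup>+z\<in>R. h z \<partial>area) s" for R
  \<comment> \<open>The incidence of R and Q is written as a 0/1 kernel on all of \<open>W1\<close>,
    so that the two sums can be interchanged afterwards.\<close>
  have bound: "y Q \<le> ennreal (real K powr s) * (\<integral>\<^sup>+R. y R * (if R \<inter> Q \<noteq> {} then 1 else 0) \<partial>count_space W1)"
    if Q: "Q \<in> W2" for Q
  proof -
    define I where "I = {R\<in>W1. R \<inter> Q \<noteq> {}}"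
    have I: "finite I" "card I \<le> K" "I \<subseteq> W1" using K(2)[OF Q] by (auto simp: I_def)
    have "(\<integral>\<^sup>+z\<in>Q. h z \<partial>area) \<le> (\<integral>\<^sup>+z. (\<Sum>R\<in>I. h z * indicator R z) \<partial>area)"
    proof (intro nn_integral_mono_AE)
      show "AE z in area. h z * indicator Q z \<le> (\<Sum>R\<in>I. h z * indicator R z)"
        using whitney_decomposition_AE_cover[OF W1]
      proof eventually_elim
        case (elim z)
        show ?case
        proof (cases "z \<in> Q")
          case True
          then obtain R where R: "R \<in> I" "z \<in> R" using elim by (auto simp: I_def)
          have "h z * indicator Q z = h z * indicator R z" using True R by simp
          also have "\<dots> \<le> (\<Sum>R\<in>I. h z * indicator R z)"
            using I R by (intro member_le_sum) auto
          finally show ?thesis .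
        qed simp
      qed
    qed
    also have "\<dots> = (\<Sum>R\<in>I. \<integral>\<^sup>+z\<in>R. h z \<partial>area)"
      using I(3) by (intro nn_integral_sum) (auto intro!: measurable)
    finally have "y Q \<le> ennreal_powr (\<Sum>R\<in>I. \<integral>\<^sup>+z\<in>R. h z \<partial>area) s"
      unfolding y_def using s by (rule ennreal_powr_mono)
    also have "\<dots> \<le> ennreal (real K powr s) * (\<Sum>R\<in>I. y R)"
      unfolding y_def by (intro ennreal_powr_sum_le I K s)
    also have "(\<Sum>R\<in>I. y R) = (\<integral>\<^sup>+R. y R * (if R \<inter> Q \<noteq> {} then 1 else 0) \<partial>count_space W1)"
      using I by (subst nn_integral_count_space'[where A=I]) (auto simp: I_def)
    finally show ?thesis .
  qed
  have "(\<Sum>\<^sub>\<infinity>Q\<in>W2. y Q) = (\<integral>\<^sup>+Q. y Q \<partial>count_space W2)"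
    using cnt by (simp add: infsum_eq_nn_integral_count_space)
  also have "\<dots> \<le> (\<integral>\<^sup>+Q. ennreal (real K powr s) *
      (\<integral>\<^sup>+R. y R * (if R \<inter> Q \<noteq> {} then 1 else 0) \<partial>count_space W1) \<partial>count_space W2)"
    using bound by (intro nn_integral_mono) auto
  also have "\<dots> = ennreal (real K powr s) *
      (\<integral>\<^sup>+Q. \<integral>\<^sup>+R. y R * (if R \<inter> Q \<noteq> {} then 1 else 0) \<partial>count_space W1 \<partial>count_space W2)"
    by (intro nn_integral_cmult) simp
  also have "(\<integral>\<^sup>+Q. \<integral>\<^sup>+R. y R * (if R \<inter> Q \<noteq> {} then 1 else 0) \<partial>count_space W1 \<partial>count_space W2) =
      (\<integral>\<^sup>+R. \<integral>\<^sup>+Q. y R * (if R \<inter> Q \<noteq> {} then 1 else 0) \<partial>count_space W2 \<partial>count_space W1)"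
    using cnt by (intro nn_integral_count_space_nn_integral) auto
  also have "\<dots> \<le> (\<integral>\<^sup>+R. of_nat L * y R \<partial>count_space W1)"
  proof (intro nn_integral_mono)
    fix R assume "R \<in> space (count_space W1)"
    then have R: "R \<in> W1" by simp
    define J where "J = {Q\<in>W2. Q \<inter> R \<noteq> {}}"
    have J: "finite J" "card J \<le> L" "J \<subseteq> W2" using L[OF R] by (auto simp: J_def)
    have "(\<integral>\<^sup>+Q. y R * (if R \<inter> Q \<noteq> {} then 1 else 0) \<partial>count_space W2) = (\<Sum>Q\<in>J. y R)"
      using J by (subst nn_integral_count_space'[where A=J]) (auto simp: J_def Int_commute)
    also have "\<dots> \<le> of_nat L * y R"
      using J(2) by (simp add: mult_right_mono)
    finally show "(\<integral>\<^sup>+Q. y R * (if R \<inter> Q \<noteq> {} then 1 else 0) \<partial>count_space W2) \<le> of_nat L * y R" .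
  qed
  also have "\<dots> = of_nat L * (\<Sum>\<^sub>\<infinity>R\<in>W1. y R)"
    using cnt by (simp add: infsum_eq_nn_integral_count_space nn_integral_cmult)
  finally have "(\<Sum>\<^sub>\<infinity>Q\<in>W2. y Q) \<le> ennreal (real K powr s) * (of_nat L * (\<Sum>\<^sub>\<infinity>R\<in>W1. y R))"
    by (simp add: mult_left_mono)
  also have "\<dots> < \<infinity>"
    using fin by (simp add: y_def ennreal_mult_less_top of_nat_less_top)
  finally show ?thesis by (simp add: y_def)
qed

subsection \<open>The three laws\<close>

text \<open>For complex c the map \<open>Re (c * x)\<close> is an arbitrary real linear functional
  of x, so the last clause is a subgaussian bound in every direction of the plane.\<close>

definition normalized_subgaussian_law :: "complex measure \<Rightarrow> bool" where
  "normalized_subgaussian_law \<mu> \<longleftrightarrow>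
     integrable \<mu> (\<lambda>x. x) \<and> (\<integral>x. x \<partial>\<mu>) = 0 \<and>
     integrable \<mu> (\<lambda>x. (cmod x)\<^sup>2) \<and> (\<integral>x. (cmod x)\<^sup>2 \<partial>\<mu>) = 1 \<and>
     (\<forall>c. (\<integral>\<^sup>+x. ennreal (exp (Re (c * x))) \<partial>\<mu>) \<le> ennreal (exp ((cmod c)\<^sup>2 / 2)))"

text \<open>Treats the Bernoulli and Steinhaus laws together. The variable \<open>Re (c * x)\<close>
  is centred and confined to an interval of length 2|c|, so Hoeffding's lemma gives the exponent
  (2|c|)^2 / 8 = |c|^2 / 2.\<close>

lemma normalized_subgaussian_law_unimodular:
  assumes "prob_space \<mu>" and sets [measurable_cong]: "sets \<mu> = sets borel"
    and unit: "AE x in \<mu>. cmod x = 1" and mean: "(\<integral>x. x \<partial>\<mu>) = 0"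
  shows "normalized_subgaussian_law \<mu>"
proof -
  interpret prob_space \<mu> by fact
  have int: "integrable \<mu> (\<lambda>x. x)"
    using unit by (intro integrable_const_bound[where B=1]) auto
  have int2: "integrable \<mu> (\<lambda>x. (cmod x)\<^sup>2)"
    using unit by (intro integrable_const_bound[where B=1]) auto
  have "(\<integral>x. (cmod x)\<^sup>2 \<partial>\<mu>) = (\<integral>x. 1 \<partial>\<mu>)"
    using unit by (intro integral_cong_AE) auto
  then have second: "(\<integral>x. (cmod x)\<^sup>2 \<partial>\<mu>) = 1"
    by (simp add: prob_space)
  have mgf: "(\<integral>\<^sup>+x. ennreal (exp (Re (c * x))) \<partial>\<mu>) \<le> ennreal (exp ((cmod c)\<^sup>2 / 2))" for c
  proof -
    interpret interval_bounded_random_variable \<mu> "\<lambda>x. Re (c * x)" "- cmod c" "cmod c"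
    proof
      show "AE x in \<mu>. Re (c * x) \<in> {- cmod c..cmod c}"
        using unit
      proof eventually_elim
        case (elim x)
        then show ?case
          using abs_Re_le_cmod[of "c * x"] by (simp add: norm_mult abs_le_iff del: times_complex.sel)
      qed
    qed simp
    have "(\<integral>x. Re (c * x) \<partial>\<mu>) = Re (c * (\<integral>x. x \<partial>\<mu>))"
      using int by (subst integral_Re) auto
    then have "expectation (\<lambda>x. Re (c * x)) = 0"
      using mean by simp
    from Hoeffdings_lemma_nn_integral_0[OF zero_less_one this] show ?thesis
      by (simp add: power_mult_distrib power2_eq_square)
  qed
  show ?thesis
    unfolding normalized_subgaussian_law_def using int mean int2 second mgf by blast
qed

lemma normalized_subgaussian_bernoulli: "normalized_subgaussian_law bernoulli_law"
proof (rule normalized_subgaussian_law_unimodular)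
  show "prob_space bernoulli_law"
    unfolding bernoulli_law_def by (intro prob_space.prob_space_distr) (auto intro: measure_pmf.prob_space_axioms)
  show "AE x in bernoulli_law. cmod x = 1"
    unfolding bernoulli_law_def by (subst AE_distr_iff) (auto simp: AE_measure_pmf_iff)
  have "(\<integral>x. x \<partial>bernoulli_law) = (\<integral>x. x \<partial>measure_pmf (pmf_of_set {1, -1 :: complex}))"
    unfolding bernoulli_law_def by (subst integral_distr) auto
  also have "\<dots> = (\<Sum>x\<in>{1, -1 :: complex}. pmf (pmf_of_set {1, -1}) x *\<^sub>R x)"
    by (intro integral_measure_pmf) auto
  also have "\<dots> = 0"
    by (simp add: scaleR_conv_of_real)
  finally show "(\<integral>x. x \<partial>bernoulli_law) = 0" .
qed (simp add: bernoulli_law_def)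

text \<open>Serves twice: for the mean of the Steinhaus law, with k = 1, and for the orthogonality
  relations behind Parseval's identity.\<close>

lemma integral_cis_full_period:
  fixes k :: int
  assumes "k \<noteq> 0"
  shows "((\<lambda>t. cis (of_int k * t)) has_integral 0) {0..2 * pi}"
proof -
  define F where "F t = cis (of_int k * t) / (\<i> * of_int k)" for t :: real
  have "(F has_vector_derivative cis (of_int k * t)) (at t within {0..2 * pi})" for t
  proof -
    have "((\<lambda>z. exp (\<i> * of_int k * z) / (\<i> * of_int k)) has_field_derivative
        exp (\<i> * of_int k * of_real t)) (at (of_real t))"
      using assms by (auto intro!: derivative_eq_intros)
    from has_vector_derivative_real_field[OF this] show ?thesis
      by (simp add: F_def[abs_def] cis_conv_exp mult_ac)
  qed
  then have "((\<lambda>t. cis (of_int k * t)) has_integral F (2 * pi) - F 0) {0..2 * pi}"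
    by (intro fundamental_theorem_of_calculus) auto
  moreover have "cis (of_int k * (2 * pi)) = 1"
    using cis_multiple_2pi[of "of_int k"] by (simp add: mult_ac)
  ultimately show ?thesis
    by (simp add: F_def)
qed

lemma normalized_subgaussian_steinhaus: "normalized_subgaussian_law steinhaus_law"
proof (rule normalized_subgaussian_law_unimodular)
  have em: "emeasure lborel {0..<2 * pi} = ennreal (2 * pi)" by simp
  have cis_borel [measurable]: "cis \<in> borel_measurable borel"
    by (intro borel_measurable_continuous_onI continuous_intros)
  have meas: "cis \<in> borel_measurable (uniform_measure lborel {0..<2 * pi})"
    by (subst measurable_cong_sets[of _ borel _ borel]) (auto simp: cis_borel)
  have "prob_space (uniform_measure lborel {0..<2 * pi})"
    by (intro prob_space_uniform_measure) (auto simp: em)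
  then show "prob_space steinhaus_law"
    unfolding steinhaus_law_def by (rule prob_space.prob_space_distr[OF _ meas])
  show "AE x in steinhaus_law. cmod x = 1"
    unfolding steinhaus_law_def using meas by (subst AE_distr_iff) auto
  have "uniform_measure lborel {0..<2 * pi} = density lborel (\<lambda>t. ennreal (indicator {0..<2 * pi} t / (2 * pi)))"
    unfolding uniform_measure_def em
    by (intro density_cong) (auto simp: divide_ennreal split: split_indicator simp flip: ennreal_1 simp del: ennreal_1)
  then have "(\<integral>x. x \<partial>steinhaus_law) = (\<integral>t. (indicator {0..<2 * pi} t / (2 * pi)) *\<^sub>R cis t \<partial>lborel)"
    unfolding steinhaus_law_def using meas
    by (subst integral_distr) (auto simp: integral_density)
  \<comment> \<open>Passing to the closed interval changes the integrand at a single point and gives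
    the form in which the integral over a period is known.\<close>
  also have "\<dots> = (\<integral>t. (1 / (2 * pi)) *\<^sub>R (indicator {0..2 * pi} t *\<^sub>R cis t) \<partial>lborel)"
    using AE_lborel_singleton[of "2 * pi"]
    by (intro integral_cong_AE) (measurable, auto elim!: eventually_mono split: split_indicator)
  also have "\<dots> = (1 / (2 * pi)) *\<^sub>R (LINT t:{0..2 * pi}|lborel. cis t)"
    unfolding set_lebesgue_integral_def by (rule integral_scaleR_right)
  also have "(LINT t:{0..2 * pi}|lborel. cis t) = integral {0..2 * pi} cis"
    by (intro set_borel_integral_eq_integral borel_integrable_atLeastAtMost' continuous_intros)
  also have "integral {0..2 * pi} cis = 0"
    using integral_cis_full_period[of 1] by (simp add: integral_unique)
  finally show "(\<integral>x. x \<partial>steinhaus_law) = 0" by simp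
qed (simp add: steinhaus_law_def)

lemma normalized_subgaussian_gaussian: "normalized_subgaussian_law gaussian_law"
proof -
  have int: "integrable lborel (\<lambda>t. std_normal_density t * t)" "(\<integral>t. std_normal_density t * t \<partial>lborel) = 0"
    using std_normal_moment_odd[of 0] by (auto simp: has_bochner_integral_iff)
  have int2: "integrable lborel (\<lambda>t. std_normal_density t * t\<^sup>2)"
    "(\<integral>t. std_normal_density t * t\<^sup>2 \<partial>lborel) = 1"
    using std_normal_moment_even[of 1] by (auto simp: has_bochner_integral_iff)
  have mgf: "(\<integral>\<^sup>+x. ennreal (exp (Re (c * x))) \<partial>gaussian_law) \<le> ennreal (exp ((cmod c)\<^sup>2 / 2))" for c
  proof -
    interpret P: prob_space "density lborel (normal_density (Re c) 1)"
      by (rule prob_space_normal_density) simp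
    have one: "(\<integral>\<^sup>+t. ennreal (normal_density (Re c) 1 t) \<partial>lborel) = 1"
      using P.emeasure_space_1 by (simp add: emeasure_density)
    have "(\<integral>\<^sup>+x. ennreal (exp (Re (c * x))) \<partial>gaussian_law) =
        (\<integral>\<^sup>+t. ennreal (std_normal_density t) * ennreal (exp (Re c * t)) \<partial>lborel)"
      unfolding gaussian_law_def by (simp add: nn_integral_distr nn_integral_density)
    \<comment> \<open>Completing the square: the exponential factor shifts the mean of the normal
      density to \<open>Re c\<close>. Only \<open>Re c\<close> enters because the law lives on the
      real line.\<close>
    also have "\<dots> = (\<integral>\<^sup>+t. ennreal (exp ((Re c)\<^sup>2 / 2)) * ennreal (normal_density (Re c) 1 t) \<partial>lborel)"
    proof (intro nn_integral_cong)
      fix t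
      have "std_normal_density t * exp (Re c * t) = exp ((Re c)\<^sup>2 / 2) * normal_density (Re c) 1 t"
        unfolding normal_density_def
        by (simp add: field_simps power2_eq_square flip: exp_add)
      then show "ennreal (std_normal_density t) * ennreal (exp (Re c * t)) =
          ennreal (exp ((Re c)\<^sup>2 / 2)) * ennreal (normal_density (Re c) 1 t)"
        by (simp flip: ennreal_mult)
    qed
    also have "\<dots> = ennreal (exp ((Re c)\<^sup>2 / 2))"
      using one by (simp add: nn_integral_cmult)
    also have "\<dots> \<le> ennreal (exp ((cmod c)\<^sup>2 / 2))"
      by (intro ennreal_leI) (simp add: cmod_power2)
    finally show ?thesis .
  qed
  show ?thesis
    unfolding normalized_subgaussian_law_def
  proof (intro conjI allI mgf)
    show "integrable gaussian_law (\<lambda>x. x)" "integrable gaussian_law (\<lambda>x. (cmod x)\<^sup>2)"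
      "(\<integral>x. (cmod x)\<^sup>2 \<partial>gaussian_law) = 1"
      unfolding gaussian_law_def using int int2 integrable_of_real[OF int(1), where 'a=complex]
      by (simp_all add: integrable_distr_eq integral_distr integrable_density integral_density scaleR_conv_of_real)
    have "(\<integral>x. x \<partial>gaussian_law) = (\<integral>t. complex_of_real (std_normal_density t * t) \<partial>lborel)"
      unfolding gaussian_law_def by (simp add: integral_distr integral_density scaleR_conv_of_real del: integral_complex_of_real)
    then show "(\<integral>x. x \<partial>gaussian_law) = 0"
      using int(2) by (simp del: of_real_mult)
  qed
qed

subsection \<open>Random sums\<close>

text \<open>A uniform setting for the three kinds of sequence: all later estimates come from
  independence, mean 0, second moment 1 and the exponential bound.\<close>

locale normalized_subgaussian_sequence = prob_space M for M :: "'a measure" +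
  fixes X :: "nat \<Rightarrow> 'a \<Rightarrow> complex"
  assumes indep: "indep_vars (\<lambda>_. borel) X UNIV"
    and integrable_X: "integrable M (X n)"
    and expectation_X: "expectation (X n) = 0"
    and integrable_norm_X_sq: "integrable M (\<lambda>s. (cmod (X n s))\<^sup>2)"
    and expectation_norm_X_sq: "expectation (\<lambda>s. (cmod (X n s))\<^sup>2) = 1"
    and mgf_X: "(\<integral>\<^sup>+s. ennreal (exp (Re (c * X n s))) \<partial>M) \<le> ennreal (exp ((cmod c)\<^sup>2 / 2))"
begin

lemma measurable_X [measurable]: "X n \<in> borel_measurable M"
  using integrable_X by simp

text \<open>By independence the expectation factors, and the exponents |c n|^2 / 2 add up.\<close>

lemma mgf_sum:
  "(\<integral>\<^sup>+s. ennreal (exp (Re (\<Sum>n<N. c n * X n s))) \<partial>M) \<le> ennreal (exp ((\<Sum>n<N. (cmod (c n))\<^sup>2) / 2))"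
proof -
  have "indep_vars (\<lambda>_. borel) X {..<N}"
    using indep by (rule indep_vars_subset) simp
  then have ind: "indep_vars (\<lambda>_. borel) (\<lambda>n s. ennreal (exp (Re (c n * X n s)))) {..<N}"
    by (rule indep_vars_compose2[where Y="\<lambda>n x. ennreal (exp (Re (c n * x)))"]) simp
  have "(\<integral>\<^sup>+s. ennreal (exp (Re (\<Sum>n<N. c n * X n s))) \<partial>M) =
      (\<integral>\<^sup>+s. (\<Prod>n<N. ennreal (exp (Re (c n * X n s)))) \<partial>M)"
    by (intro nn_integral_cong) (simp add: prod_ennreal exp_sum del: times_complex.sel)
  also have "\<dots> = (\<Prod>n<N. \<integral>\<^sup>+s. ennreal (exp (Re (c n * X n s))) \<partial>M)"
    by (intro indep_vars_nn_integral ind) auto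
  also have "\<dots> \<le> (\<Prod>n<N. ennreal (exp ((cmod (c n))\<^sup>2 / 2)))"
    by (induction N) (auto intro!: mult_mono mgf_X simp del: times_complex.sel)
  also have "\<dots> = ennreal (exp ((\<Sum>n<N. (cmod (c n))\<^sup>2) / 2))"
    by (simp add: prod_ennreal exp_sum sum_divide_distrib)
  finally show ?thesis .
qed

text \<open>|z| / 2 is at most one of Re z, - Re z, Im z, - Im z, and each of these is Re (u z) for
  a unimodular u. Each of the four exponentials has expectation at most exp (1 / 2) <= 2, whence
  8.\<close>

lemma exp_norm_sum:
  assumes "(\<Sum>n<N. (cmod (c n))\<^sup>2) \<le> 1"
  shows "(\<integral>\<^sup>+s. ennreal (exp (cmod (\<Sum>n<N. c n * X n s) / 2)) \<partial>M) \<le> 8"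
proof -
  define S where "S s = (\<Sum>n<N. c n * X n s)" for s
  have [measurable]: "S \<in> borel_measurable M" unfolding S_def by measurable
  have part: "(\<integral>\<^sup>+s. ennreal (exp (Re (u * S s))) \<partial>M) \<le> 2" if "cmod u = 1" for u
  proof -
    have "(\<integral>\<^sup>+s. ennreal (exp (Re (u * S s))) \<partial>M) =
        (\<integral>\<^sup>+s. ennreal (exp (Re (\<Sum>n<N. (u * c n) * X n s))) \<partial>M)"
      by (simp add: S_def sum_distrib_left mult.assoc del: times_complex.sel)
    also have "\<dots> \<le> ennreal (exp ((\<Sum>n<N. (cmod (u * c n))\<^sup>2) / 2))"
      by (rule mgf_sum)
    also have "\<dots> \<le> ennreal (exp (1 / 2))"
      using assms that by (intro ennreal_leI) (simp add: norm_mult)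
    also have "\<dots> \<le> ennreal 2"
      using exp_half_le2 by (intro ennreal_leI) simp
    finally show ?thesis by simp
  qed
  have pointwise: "exp (cmod z / 2) \<le> exp (Re (1 * z)) + exp (Re (-1 * z)) + exp (Re (\<i> * z)) + exp (Re (- \<i> * z))" for z
  proof -
    have "cmod z / 2 \<le> max \<bar>Re z\<bar> \<bar>Im z\<bar>"
      using cmod_le[of z] by linarith
    then have "cmod z / 2 \<le> Re z \<or> cmod z / 2 \<le> - Re z \<or> cmod z / 2 \<le> Im z \<or> cmod z / 2 \<le> - Im z"
      by linarith
    then have "exp (cmod z / 2) \<le> exp (Re z) \<or> exp (cmod z / 2) \<le> exp (- Re z) \<or>
        exp (cmod z / 2) \<le> exp (Im z) \<or> exp (cmod z / 2) \<le> exp (- Im z)"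
      by (simp only: exp_le_cancel_iff)
    moreover have "0 < exp (Re z)" "0 < exp (- Re z)" "0 < exp (Im z)" "0 < exp (- Im z)"
      by simp_all
    ultimately have "exp (cmod z / 2) \<le> exp (Re z) + exp (- Re z) + exp (- Im z) + exp (Im z)"
      by linarith
    then show ?thesis by simp
  qed
  have "(\<integral>\<^sup>+s. ennreal (exp (cmod (S s) / 2)) \<partial>M) \<le>
      (\<integral>\<^sup>+s. ennreal (exp (Re (1 * S s))) + ennreal (exp (Re (-1 * S s))) +
        ennreal (exp (Re (\<i> * S s))) + ennreal (exp (Re (- \<i> * S s))) \<partial>M)"
    using pointwise by (intro nn_integral_mono) (simp flip: ennreal_plus)
  also have "\<dots> = (\<integral>\<^sup>+s. ennreal (exp (Re (1 * S s))) \<partial>M) + (\<integral>\<^sup>+s. ennreal (exp (Re (-1 * S s))) \<partial>M) +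
        (\<integral>\<^sup>+s. ennreal (exp (Re (\<i> * S s))) \<partial>M) + (\<integral>\<^sup>+s. ennreal (exp (Re (- \<i> * S s))) \<partial>M)"
    by (subst nn_integral_add; measurable)+
  also have "\<dots> \<le> 2 + 2 + 2 + 2"
    by (intro add_mono part) auto
  finally show ?thesis by (simp add: S_def)
qed

lemma expectation_norm_sum_sq:
  shows "integrable M (\<lambda>s. (cmod (\<Sum>n<N. c n * X n s))\<^sup>2)"
    and "expectation (\<lambda>s. (cmod (\<Sum>n<N. c n * X n s))\<^sup>2) = (\<Sum>n<N. (cmod (c n))\<^sup>2)"
proof -
  have pair: "integrable M (\<lambda>s. X i s * cnj (X j s)) \<and>
      expectation (\<lambda>s. X i s * cnj (X j s)) = (if i = j then 1 else 0)" for i j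
  proof (cases "i = j")
    case True
    have eq: "(\<lambda>s. X j s * cnj (X j s)) = (\<lambda>s. complex_of_real ((cmod (X j s))\<^sup>2))"
      by (simp add: complex_norm_square del: of_real_power)
    show ?thesis
      unfolding True eq
      using expectation_norm_X_sq integrable_of_real[OF integrable_norm_X_sq, where 'a=complex]
      by (simp del: of_real_power)
  next
    case False
    \<comment> \<open>Conjugating only the variable with index j turns
      \<open>X i s * cnj (X j s)\<close> into a product over the independent family indexed by {i,
      j}; its expectation vanishes because that of X i does.\<close>
    define Y where "Y k s = (if k = j then cnj (X k s) else X k s)" for k s
    have ind: "indep_vars (\<lambda>_. borel) Y {i, j}"
      unfolding Y_def[abs_def]
      using False borel_measurable_continuous_onI[OF continuous_on_cnj[OF continuous_on_id]]
      by (intro indep_vars_compose2[OF indep_vars_subset[OF indep], where Y="\<lambda>k x. if k = j then cnj x else x"]) auto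
    have intY: "integrable M (Y k)" for k
      using integrable_X[of k] integrable_cnj[OF integrable_X[of k]]
      by (cases "k = j") (simp_all add: Y_def[abs_def])
    have "expectation (Y i) = 0"
      using False expectation_X[of i] by (simp add: Y_def[abs_def])
    then show ?thesis
      using indep_vars_lebesgue_integral[OF _ ind intY] indep_vars_integrable[OF _ ind intY] False
      by (simp add: Y_def[abs_def])
  qed
  have eq: "complex_of_real ((cmod (\<Sum>n<N. c n * X n s))\<^sup>2) =
      (\<Sum>i<N. \<Sum>j<N. (c i * cnj (c j)) * (X i s * cnj (X j s)))" for s
    by (simp only: complex_norm_square cnj_sum sum_product complex_cnj_mult) (simp add: mult_ac)
  have int: "integrable M (\<lambda>s. complex_of_real ((cmod (\<Sum>n<N. c n * X n s))\<^sup>2))"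
    unfolding eq using pair by (intro Bochner_Integration.integrable_sum integrable_mult_right) auto
  from integrable_Re[OF this] show "integrable M (\<lambda>s. (cmod (\<Sum>n<N. c n * X n s))\<^sup>2)"
    by simp
  have "complex_of_real (expectation (\<lambda>s. (cmod (\<Sum>n<N. c n * X n s))\<^sup>2)) =
      (\<integral>s. (\<Sum>i<N. \<Sum>j<N. (c i * cnj (c j)) * (X i s * cnj (X j s))) \<partial>M)"
    unfolding eq[symmetric] by (rule integral_complex_of_real[symmetric])
  also have "\<dots> = (\<Sum>i<N. \<Sum>j<N. (c i * cnj (c j)) * expectation (\<lambda>s. X i s * cnj (X j s)))"
    using pair by (subst Bochner_Integration.integral_sum; simp)+
  also have "\<dots> = (\<Sum>i<N. c i * cnj (c i))"
    using pair by (simp add: if_distrib[of "(*) _"] sum.delta cong: if_cong)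
  also have "\<dots> = complex_of_real (\<Sum>i<N. (cmod (c i))\<^sup>2)"
    by (simp add: complex_norm_square del: of_real_power)
  finally show "expectation (\<lambda>s. (cmod (\<Sum>n<N. c n * X n s))\<^sup>2) = (\<Sum>n<N. (cmod (c n))\<^sup>2)"
    by (simp only: of_real_eq_iff)
qed

end

section \<open>Two elementary inequalities for powers\<close>

lemma powr_le_exp_half:
  fixes x t :: real
  assumes "0 \<le> x" "0 < t"
  shows "x powr t \<le> (2 * t) powr t * exp (x / 2)"
proof -
  \<comment> \<open>For this y, raising y <= exp y to the power t produces exactly exp (x / 2), the
    quantity bounded in \<open>exp_norm_sum\<close>.\<close>
  define y where "y = x / (2 * t)"
  have y: "0 \<le> y" using assms by (simp add: y_def)
  have "y powr t \<le> exp y powr t"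
    using y assms exp_ge_add_one_self[of y] by (intro powr_mono2) linarith+
  also have "\<dots> = exp (x / 2)"
    using assms by (simp add: y_def exp_powr_real)
  finally have "(2 * t) powr t * y powr t \<le> (2 * t) powr t * exp (x / 2)"
    by (intro mult_left_mono) auto
  moreover have "x powr t = (2 * t) powr t * y powr t"
    using assms y by (simp add: y_def flip: powr_mult)
  ultimately show ?thesis by simp
qed

text \<open>Exchanges the first power for the r-th at the price of an error e: below e the first
  summand suffices, and above e the second is at least 1. It carries lower bounds for expectations
  of bounded variables from one power to another and replaces the usual Paley-Zygmund step.\<close>

lemma min_one_le_min_powr:
  fixes x e r :: real
  assumes "0 \<le> x" "0 < e" "e \<le> 1" "0 < r"
  shows "min x 1 \<le> e + min (x powr r) 1 / e powr r"
proof (cases "x < e")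
  case False
  then have "e powr r \<le> x powr r" "e powr r \<le> 1"
    using assms by (auto intro: powr_mono2 powr_le1)
  then have "1 \<le> min (x powr r) 1 / e powr r"
    using assms by (simp add: le_divide_eq)
  then show ?thesis using assms by linarith
next
  case True
  moreover have "0 \<le> min (x powr r) 1 / e powr r" by simp
  ultimately show ?thesis by linarith
qed

context normalized_subgaussian_sequence
begin

text \<open>Fatou's lemma carries the uniform bound for partial sums over to the almost surely
  convergent series.\<close>

lemma exp_norm_suminf:
  assumes sum1: "summable (\<lambda>n. (cmod (c n))\<^sup>2)" "(\<Sum>n. (cmod (c n))\<^sup>2) \<le> 1"
    and conv: "AE s in M. summable (\<lambda>n. c n * X n s)"
  shows "(\<integral>\<^sup>+s. ennreal (exp (cmod (\<Sum>n. c n * X n s) / 2)) \<partial>M) \<le> 8"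
proof -
  define S where "S N s = (\<Sum>n<N. c n * X n s)" for N s
  have [measurable]: "S N \<in> borel_measurable M" for N unfolding S_def[abs_def] by measurable
  have "(\<integral>\<^sup>+s. ennreal (exp (cmod (\<Sum>n. c n * X n s) / 2)) \<partial>M) \<le>
      (\<integral>\<^sup>+s. liminf (\<lambda>N. ennreal (exp (cmod (S N s) / 2))) \<partial>M)"
  proof (intro nn_integral_mono_AE)
    show "AE s in M. ennreal (exp (cmod (\<Sum>n. c n * X n s) / 2)) \<le>
        liminf (\<lambda>N. ennreal (exp (cmod (S N s) / 2)))"
      using conv
    proof eventually_elim
      case (elim s)
      then have "(\<lambda>N. S N s) \<longlonglongrightarrow> (\<Sum>n. c n * X n s)"
        unfolding S_def by (rule summable_LIMSEQ)
      then have "(\<lambda>N. ennreal (exp (cmod (S N s) / 2))) \<longlonglongrightarrow> ennreal (exp (cmod (\<Sum>n. c n * X n s) / 2))"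
        by (intro tendsto_intros) auto
      from lim_imp_Liminf[OF _ this] show ?case by simp
    qed
  qed
  also have "\<dots> \<le> liminf (\<lambda>N. \<integral>\<^sup>+s. ennreal (exp (cmod (S N s) / 2)) \<partial>M)"
    by (rule nn_integral_liminf) measurable
  also have "\<dots> \<le> 8"
  proof (rule Liminf_le)
    show "\<forall>\<^sub>F N in sequentially. (\<integral>\<^sup>+s. ennreal (exp (cmod (S N s) / 2)) \<partial>M) \<le> 8"
    proof (intro always_eventually allI)
      fix N
      have "(\<Sum>n<N. (cmod (c n))\<^sup>2) \<le> 1"
        using sum_le_suminf[OF sum1(1), of "{..<N}"] sum1(2) by simp
      then show "(\<integral>\<^sup>+s. ennreal (exp (cmod (S N s) / 2)) \<partial>M) \<le> 8"
        unfolding S_def by (rule exp_norm_sum)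
    qed
  qed simp
  finally show ?thesis .
qed

lemma nn_integral_powr_le_exp:
  assumes [measurable]: "Z \<in> borel_measurable M" and "0 < t"
    and "(\<integral>\<^sup>+s. ennreal (exp (cmod (Z s) / 2)) \<partial>M) \<le> 8"
  shows "(\<integral>\<^sup>+s. ennreal (cmod (Z s) powr t) \<partial>M) \<le> ennreal (8 * (2 * t) powr t)"
proof -
  have "(\<integral>\<^sup>+s. ennreal (cmod (Z s) powr t) \<partial>M) \<le>
      (\<integral>\<^sup>+s. ennreal ((2 * t) powr t) * ennreal (exp (cmod (Z s) / 2)) \<partial>M)"
    using assms(2) by (intro nn_integral_mono) (auto simp flip: ennreal_mult intro!: ennreal_leI powr_le_exp_half)
  also have "\<dots> = ennreal ((2 * t) powr t) * (\<integral>\<^sup>+s. ennreal (exp (cmod (Z s) / 2)) \<partial>M)"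
    by (intro nn_integral_cmult) measurable
  also have "\<dots> \<le> ennreal ((2 * t) powr t) * 8"
    by (intro mult_left_mono assms) simp
  also have "\<dots> = ennreal (8 * (2 * t) powr t)"
    by (simp add: ennreal_mult mult.commute)
  finally show ?thesis .
qed

text \<open>The second moments of the partial sums are kept in the limit by the bounded function
  \<open>min (x\<^sup>2) K\<close>, since the fourth moments control \<open>x\<^sup>2 - min (x\<^sup>2) K\<close>.\<close>

lemma truncated_second_moment:
  assumes sum1: "(\<lambda>n. (cmod (c n))\<^sup>2) sums 1"
    and conv: "AE s in M. summable (\<lambda>n. c n * X n s)"
  shows "ennreal (1 / 2) \<le> (\<integral>\<^sup>+s. ennreal (min ((cmod (\<Sum>n. c n * X n s))\<^sup>2) 65536) \<partial>M)"
proof -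
  define S where "S N s = (\<Sum>n<N. c n * X n s)" for N s
  have [measurable]: "S N \<in> borel_measurable M" for N unfolding S_def[abs_def] by measurable
  define I where "I N = (\<integral>\<^sup>+s. ennreal (min ((cmod (S N s))\<^sup>2) 65536) \<partial>M)" for N
  have bound: "ennreal (\<Sum>n<N. (cmod (c n))\<^sup>2) \<le> I N + ennreal (1 / 2)" for N
  proof -
    have le1: "(\<Sum>n<N. (cmod (c n))\<^sup>2) \<le> 1"
      using sum_le_suminf[OF sums_summable[OF sum1], of "{..<N}"] sums_unique[OF sum1] by simp
    \<comment> \<open>For t = 4 the bound 8 * (2 * t)^t equals 32768. The truncation level 65536 is
      twice that, so truncating costs at most 1 / 2 of a second moment that tends to 1.\<close>
    have fourth: "(\<integral>\<^sup>+s. ennreal (cmod (S N s) powr 4) \<partial>M) \<le> ennreal 32768"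
      using nn_integral_powr_le_exp[of "S N" 4] exp_norm_sum[OF le1] by (simp add: S_def)
    have pointwise: "x\<^sup>2 \<le> min (x\<^sup>2) 65536 + x powr 4 / 65536" if "0 \<le> x" for x :: real
    proof (cases "x\<^sup>2 \<le> 65536")
      case False
      then have "x\<^sup>2 * 65536 \<le> x\<^sup>2 * x\<^sup>2" by (intro mult_left_mono) auto
      moreover have "x powr 4 = x\<^sup>2 * x\<^sup>2"
      proof -
        have "x > 0" using False that by (cases "x = 0") auto
        then show ?thesis by (simp add: powr_numeral power_numeral_reduce)
      qed
      ultimately have "x\<^sup>2 \<le> x powr 4 / 65536" by simp
      then show ?thesis using False by linarith
    qed simp
    have "ennreal (\<Sum>n<N. (cmod (c n))\<^sup>2) = (\<integral>\<^sup>+s. ennreal ((cmod (S N s))\<^sup>2) \<partial>M)"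
      using expectation_norm_sum_sq[of c N] unfolding S_def
      by (subst nn_integral_eq_integral) auto
    also have "\<dots> \<le> (\<integral>\<^sup>+s. ennreal (min ((cmod (S N s))\<^sup>2) 65536) +
        ennreal (1 / 65536) * ennreal (cmod (S N s) powr 4) \<partial>M)"
      using pointwise by (intro nn_integral_mono) (simp flip: ennreal_mult ennreal_plus)
    also have "\<dots> = I N + ennreal (1 / 65536) * (\<integral>\<^sup>+s. ennreal (cmod (S N s) powr 4) \<partial>M)"
      unfolding I_def by (simp add: nn_integral_add nn_integral_cmult)
    also have "\<dots> \<le> I N + ennreal (1 / 65536) * ennreal 32768"
      by (intro add_left_mono mult_left_mono fourth) simp
    also have "ennreal (1 / 65536) * ennreal 32768 = ennreal (1 / 2)"
      by (subst ennreal_mult[symmetric]) auto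
    finally show ?thesis .
  qed
  have lim: "I \<longlonglongrightarrow> (\<integral>\<^sup>+s. ennreal (min ((cmod (\<Sum>n. c n * X n s))\<^sup>2) 65536) \<partial>M)"
    unfolding I_def
  proof (rule nn_integral_dominated_convergence[where w="\<lambda>_. 65536"])
    show "AE s in M. (\<lambda>N. ennreal (min ((cmod (S N s))\<^sup>2) 65536)) \<longlonglongrightarrow>
        ennreal (min ((cmod (\<Sum>n. c n * X n s))\<^sup>2) 65536)"
      using conv
    proof eventually_elim
      case (elim s)
      then have "(\<lambda>N. S N s) \<longlonglongrightarrow> (\<Sum>n. c n * X n s)"
        unfolding S_def by (rule summable_LIMSEQ)
      then show ?case by (intro tendsto_intros) auto
    qed
    show "(\<integral>\<^sup>+s. 65536 \<partial>M) < \<infinity>" by (simp add: emeasure_space_1)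
    show "AE s in M. ennreal (min ((cmod (S N s))\<^sup>2) 65536) \<le> 65536" for N
      by (intro AE_I2) (metis ennreal_leI ennreal_numeral min.cobounded2 zero_le_numeral)
  qed measurable
  have "ennreal 1 \<le> (\<integral>\<^sup>+s. ennreal (min ((cmod (\<Sum>n. c n * X n s))\<^sup>2) 65536) \<partial>M) + ennreal (1 / 2)"
  proof (rule LIMSEQ_le)
    show "(\<lambda>N. ennreal (\<Sum>n<N. (cmod (c n))\<^sup>2)) \<longlonglongrightarrow> ennreal 1"
      using sum1 by (intro tendsto_ennrealI) (simp add: sums_def)
    show "(\<lambda>N. I N + ennreal (1 / 2)) \<longlonglongrightarrow>
        (\<integral>\<^sup>+s. ennreal (min ((cmod (\<Sum>n. c n * X n s))\<^sup>2) 65536) \<partial>M) + ennreal (1 / 2)"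
      by (intro tendsto_add lim tendsto_const)
  qed (use bound in blast)
  then have "ennreal 1 - ennreal (1 / 2) \<le> (\<integral>\<^sup>+s. ennreal (min ((cmod (\<Sum>n. c n * X n s))\<^sup>2) 65536) \<partial>M)"
    by (simp add: ennreal_minus_le_iff add.commute)
  moreover have "ennreal 1 - ennreal (1 / 2) = ennreal (1 / 2)"
    by (subst ennreal_minus) auto
  ultimately show ?thesis by simp
qed

text \<open>Dividing by V reduces to coefficients of square sum 1, where the exponential moment is
  at most 8 and dominates every power. If V = 0, all coefficients vanish.\<close>

lemma moment_suminf_le:
  assumes V: "0 \<le> V" "(\<lambda>n. (cmod (c n))\<^sup>2) sums V\<^sup>2" and t: "0 < t"
    and conv: "AE s in M. summable (\<lambda>n. c n * X n s)"
  shows "(\<integral>\<^sup>+s. ennreal (cmod (\<Sum>n. c n * X n s) powr t) \<partial>M) \<le> ennreal (8 * (2 * t) powr t * V powr t)"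
proof (cases "V = 0")
  case True
  then have "c n = 0" for n
    using V(2) suminf_eq_zero_iff[of "\<lambda>n. (cmod (c n))\<^sup>2"] by (auto simp: sums_iff)
  then show ?thesis by simp
next
  case False
  then have V0: "0 < V" using V by simp
  define d where "d n = c n / of_real V" for n
  have d: "(\<lambda>n. (cmod (d n))\<^sup>2) sums 1"
    using sums_divide[OF V(2), of "V\<^sup>2"] V0 by (simp add: d_def norm_divide power_divide)
  have convd: "AE s in M. summable (\<lambda>n. d n * X n s)"
    using conv
  proof eventually_elim
    case (elim s)
    from summable_divide[OF this, of "of_real V"] show ?case by (simp add: d_def)
  qed
  have eq: "AE s in M. (\<Sum>n. c n * X n s) = of_real V * (\<Sum>n. d n * X n s)"
    using convd
  proof eventually_elim
    case (elim s)
    then show ?case using V0 by (simp add: suminf_mult[symmetric] d_def)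
  qed
  have "(\<integral>\<^sup>+s. ennreal (cmod (\<Sum>n. c n * X n s) powr t) \<partial>M) =
      (\<integral>\<^sup>+s. ennreal (V powr t) * ennreal (cmod (\<Sum>n. d n * X n s) powr t) \<partial>M)"
    using eq by (intro nn_integral_cong_AE, eventually_elim)
      (use V0 in \<open>simp add: norm_mult powr_mult flip: ennreal_mult\<close>)
  also have "\<dots> = ennreal (V powr t) * (\<integral>\<^sup>+s. ennreal (cmod (\<Sum>n. d n * X n s) powr t) \<partial>M)"
    by (intro nn_integral_cmult) measurable
  also have "\<dots> \<le> ennreal (V powr t) * ennreal (8 * (2 * t) powr t)"
  proof (intro mult_left_mono nn_integral_powr_le_exp)
    show "(\<integral>\<^sup>+s. ennreal (exp (cmod (\<Sum>n. d n * X n s) / 2)) \<partial>M) \<le> 8"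
      using d convd by (intro exp_norm_suminf) (auto simp: sums_iff)
  qed (use t in measurable)
  also have "\<dots> = ennreal (8 * (2 * t) powr t * V powr t)"
    by (simp add: mult_ac flip: ennreal_mult)
  finally show ?thesis .
qed

text \<open>The value is e^(p/2) / (4 * 65536) with e = 1 / (4 * 65536), as it comes out of
  \<open>truncated_moment_suminf_ge\<close>.\<close>

definition kappa :: "real \<Rightarrow> real" where
  "kappa p = (1 / 262144) powr (p / 2) / 262144"

lemma kappa_pos: "0 < kappa p"
  by (simp add: kappa_def)

text \<open>After normalisation the truncated second moment is at least 1 / 2, and
  \<open>min_one_le_min_powr\<close>, applied to the square with exponent p / 2, turns this into a
  lower bound for the truncated p-th moment.\<close>

lemma truncated_moment_suminf_ge:
  assumes V: "0 \<le> V" "(\<lambda>n. (cmod (c n))\<^sup>2) sums V\<^sup>2" and p: "0 < p"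
    and conv: "AE s in M. summable (\<lambda>n. c n * X n s)"
  shows "ennreal (kappa p * V powr p) \<le>
    (\<integral>\<^sup>+s. ennreal (min (cmod (\<Sum>n. c n * X n s) powr p) (V powr p)) \<partial>M)"
proof (cases "V = 0")
  case False
  then have V0: "0 < V" using V by simp
  define d where "d n = c n / of_real V" for n
  have d: "(\<lambda>n. (cmod (d n))\<^sup>2) sums 1"
    using sums_divide[OF V(2), of "V\<^sup>2"] V0 by (simp add: d_def norm_divide power_divide)
  have convd: "AE s in M. summable (\<lambda>n. d n * X n s)"
    using conv
  proof eventually_elim
    case (elim s)
    from summable_divide[OF this, of "of_real V"] show ?case by (simp add: d_def)
  qed
  define G where "G s = cmod (\<Sum>n. d n * X n s)" for s
  have [measurable]: "G \<in> borel_measurable M" unfolding G_def[abs_def] by measurable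
  have eq: "AE s in M. cmod (\<Sum>n. c n * X n s) = V * G s"
    using convd
  proof eventually_elim
    case (elim s)
    then have "(\<Sum>n. c n * X n s) = of_real V * (\<Sum>n. d n * X n s)"
      using V0 by (simp add: suminf_mult[symmetric] d_def)
    then show ?case using V0 by (simp add: G_def norm_mult)
  qed
  \<comment> \<open>Chosen so that 65536 * e = 1 / 4, half of the available lower bound 1 /
    2.\<close>
  define e :: real where "e = 1 / 262144"
  define J where "J = (\<integral>\<^sup>+s. ennreal (min (G s powr p) 1) \<partial>M)"
  have e: "0 < e" "e \<le> 1" by (auto simp: e_def)
  have pointwise: "min (x\<^sup>2) 65536 \<le> 1 / 4 + 65536 / e powr (p / 2) * min (x powr p) 1" if x: "0 \<le> x" for x
  proof -
    have "min (x\<^sup>2) 65536 \<le> 65536 * min (x\<^sup>2) 1" by (auto simp: min_def)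
    also have "\<dots> \<le> 65536 * (e + min ((x\<^sup>2) powr (p / 2)) 1 / e powr (p / 2))"
      using p e by (intro mult_left_mono min_one_le_min_powr) auto
    also have "(x\<^sup>2) powr (p / 2) = x powr p"
    proof (cases "x = 0")
      case False
      then have "x\<^sup>2 = x powr 2" using x by simp
      then show ?thesis by (simp add: powr_powr)
    qed simp
    finally show ?thesis by (simp add: e_def algebra_simps)
  qed
  have "ennreal (1 / 2) \<le> (\<integral>\<^sup>+s. ennreal (min ((G s)\<^sup>2) 65536) \<partial>M)"
    unfolding G_def by (rule truncated_second_moment[OF d convd])
  also have "\<dots> \<le> (\<integral>\<^sup>+s. ennreal (1 / 4) + ennreal (65536 / e powr (p / 2)) * ennreal (min (G s powr p) 1) \<partial>M)"
    using pointwise by (intro nn_integral_mono) (simp add: G_def flip: ennreal_mult ennreal_plus)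
  also have "\<dots> = ennreal (1 / 4) + ennreal (65536 / e powr (p / 2)) * J"
    unfolding J_def by (simp add: nn_integral_add nn_integral_cmult emeasure_space_1)
  finally have *: "ennreal (1 / 2) \<le> ennreal (1 / 4) + ennreal (65536 / e powr (p / 2)) * J" .
  have J: "J \<le> 1"
  proof -
    have "J \<le> (\<integral>\<^sup>+s. 1 \<partial>M)"
      unfolding J_def by (intro nn_integral_mono) (simp add: min_le_iff_disj)
    then show ?thesis by (simp add: emeasure_space_1)
  qed
  then obtain j where j: "0 \<le> j" "J = ennreal j"
    by (cases J) (auto simp: top_unique)
  have affine: "ennreal (1 / 4 + B * j) = ennreal (1 / 4) + ennreal B * ennreal j" if "0 \<le> B" for B
    using that j(1) by (simp add: ennreal_mult)
  have "1 / 2 \<le> 1 / 4 + 65536 / e powr (p / 2) * j"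
  proof (rule ennreal_le_iff[THEN iffD1])
    show "ennreal (1 / 2) \<le> ennreal (1 / 4 + 65536 / e powr (p / 2) * j)"
      using * affine[of "65536 / e powr (p / 2)"] by (simp only: j(2)) simp
  qed (use j e in auto)
  then have "kappa p \<le> j"
    using e by (simp add: kappa_def e_def field_simps)
  then have "ennreal (kappa p * V powr p) \<le> ennreal (V powr p) * J"
    using j mult_right_mono[of "kappa p" j "V powr p"]
    by (simp add: mult.commute ennreal_leI flip: ennreal_mult)
  also have "\<dots> = (\<integral>\<^sup>+s. ennreal (V powr p) * ennreal (min (G s powr p) 1) \<partial>M)"
    unfolding J_def by (intro nn_integral_cmult[symmetric]) measurable
  also have "\<dots> = (\<integral>\<^sup>+s. ennreal (min (cmod (\<Sum>n. c n * X n s) powr p) (V powr p)) \<partial>M)"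
    using eq
  proof (intro nn_integral_cong_AE, eventually_elim)
    case (elim s)
    have "V powr p * min (G s powr p) 1 = min (V powr p * G s powr p) (V powr p)"
      using V0 by (simp add: min_mult_distrib_left)
    then show ?case
      using elim V0 by (simp add: powr_mult G_def flip: ennreal_mult)
  qed
  finally show ?thesis .
qed simp

end

subsection \<open>Taylor coefficients\<close>

lemma taylor_coeff_sums:
  assumes "f holomorphic_on unit_disk" "z \<in> unit_disk"
  shows "(\<lambda>n. taylor_coeff f n * z ^ n) sums f z"
  using holomorphic_power_series[OF assms] by (simp add: taylor_coeff_def)

lemma taylor_coeff_summable_norm:
  assumes "f holomorphic_on unit_disk" "cmod z < 1"
  shows "summable (\<lambda>n. cmod (taylor_coeff f n * z ^ n))"
proof -
  obtain r where r: "cmod z < r" "r < 1" using assms(2) dense by blast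
  then have "0 \<le> r" using norm_ge_zero[of z] by linarith
  with r have "complex_of_real r \<in> unit_disk" by simp
  then have "summable (\<lambda>n. taylor_coeff f n * of_real r ^ n)"
    using taylor_coeff_sums[OF assms(1)] sums_summable by blast
  then show ?thesis
    by (rule powser_insidea) (use r \<open>0 \<le> r\<close> in simp)
qed

text \<open>On a circle of radius r < 1 the Taylor series converges uniformly, so the integrals of
  |P N|^2, computed from the orthogonality of the exponentials, converge to that of |F|^2.\<close>

lemma parseval_M2:
  assumes f: "f holomorphic_on unit_disk" and r: "0 \<le> r" "r < 1"
  shows "(\<lambda>n. (cmod (taylor_coeff f n * of_real r ^ n))\<^sup>2) sums (M2 f r)\<^sup>2"
proof -
  define b where "b n = taylor_coeff f n * of_real r ^ n" for n
  define F where "F t = f (of_real r * cis t)" for t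
  define P where "P N t = (\<Sum>n<N. b n * cis (of_nat n * t))" for N :: nat and t
  have disk: "of_real r * cis t \<in> unit_disk" for t
    using r by (simp add: norm_mult)
  have Feq: "F t = (\<Sum>n. b n * cis (of_nat n * t))" for t
  proof -
    have "taylor_coeff f n * (of_real r * cis t) ^ n = b n * cis (of_nat n * t)" for n
      by (simp only: b_def power_mult_distrib Complex.DeMoivre mult.assoc)
    then show ?thesis
      using taylor_coeff_sums[OF f disk[of t]] by (simp add: F_def sums_iff)
  qed
  have contF: "continuous_on {0..2 * pi} F"
    unfolding F_def using disk
    by (intro continuous_on_compose2[OF holomorphic_on_imp_continuous_on[OF f]] continuous_intros) auto
  have bddF: "bounded (F ` {0..2 * pi})"
    by (intro compact_imp_bounded compact_continuous_image contF) simp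
  have "uniform_limit {0..2 * pi} P F sequentially"
    unfolding P_def[abs_def] Feq[abs_def]
  proof (rule Weierstrass_m_test)
    show "summable (\<lambda>n. cmod (b n))"
      unfolding b_def using taylor_coeff_summable_norm[OF f, of "of_real r"] r by simp
  qed (simp add: norm_mult)
  moreover from this have "uniform_limit {0..2 * pi} (\<lambda>N t. cnj (P N t)) (\<lambda>t. cnj (F t)) sequentially"
    by (rule bounded_linear.uniform_limit[OF bounded_linear_cnj])
  moreover have "bounded ((\<lambda>t. cnj (F t)) ` {0..2 * pi})"
    by (intro compact_imp_bounded compact_continuous_image continuous_intros contF) simp
  ultimately have lim: "uniform_limit {0..2 * pi} (\<lambda>N t. P N t * cnj (P N t)) (\<lambda>t. F t * cnj (F t)) sequentially"
    using bddF by (intro uniform_lim_mult)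
  have PI: "((\<lambda>t. P N t * cnj (P N t)) has_integral of_real (2 * pi * (\<Sum>n<N. (cmod (b n))\<^sup>2))) {0..2 * pi}" for N
  proof -
    have orth: "((\<lambda>t. (b i * cnj (b j)) * cis (of_int (int i - int j) * t)) has_integral
        (b i * cnj (b j)) * (if i = j then of_real (2 * pi) else 0)) {0..2 * pi}" for i j
    proof (rule has_integral_mult_right)
      show "((\<lambda>t. cis (of_int (int i - int j) * t)) has_integral (if i = j then of_real (2 * pi) else 0)) {0..2 * pi}"
        using integral_cis_full_period[of "int i - int j"] has_integral_const_real[of "1::complex" 0 "2 * pi"]
        by (auto simp: scaleR_conv_of_real)
    qed
    have "((\<lambda>t. \<Sum>i<N. \<Sum>j<N. (b i * cnj (b j)) * cis (of_int (int i - int j) * t)) has_integral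
        (\<Sum>i<N. \<Sum>j<N. (b i * cnj (b j)) * (if i = j then of_real (2 * pi) else 0))) {0..2 * pi}"
      by (intro has_integral_sum orth) auto
    moreover have "(\<Sum>i<N. \<Sum>j<N. (b i * cnj (b j)) * cis (of_int (int i - int j) * t)) = P N t * cnj (P N t)" for t
    proof -
      have "cis (of_int (int i - int j) * t) = cis (of_nat i * t) * cnj (cis (of_nat j * t))" for i j
        by (simp add: cis_cnj cis_mult algebra_simps)
      then show ?thesis
        unfolding P_def cnj_sum sum_product by (simp add: mult_ac)
    qed
    moreover have "(\<Sum>i<N. \<Sum>j<N. (b i * cnj (b j)) * (if i = j then of_real (2 * pi) else 0)) =
        of_real (2 * pi * (\<Sum>n<N. (cmod (b n))\<^sup>2))"
    proof -
      have "(\<Sum>i<N. \<Sum>j<N. (b i * cnj (b j)) * (if i = j then of_real (2 * pi) else 0)) =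
          (\<Sum>i<N. (b i * cnj (b i)) * of_real (2 * pi))"
        by (simp add: if_distrib[of "(*) _"] sum.delta cong: if_cong)
      also have "\<dots> = of_real (2 * pi * (\<Sum>n<N. (cmod (b n))\<^sup>2))"
        by (simp add: complex_norm_square sum_distrib_left mult_ac del: of_real_power)
      finally show ?thesis .
    qed
    ultimately show ?thesis by simp
  qed
  have contP: "continuous_on {0..2 * pi} (\<lambda>t. P N t * cnj (P N t))" for N
    unfolding P_def by (intro continuous_intros)
  obtain I J where I: "\<And>N. ((\<lambda>t. P N t * cnj (P N t)) has_integral I N) {0..2 * pi}"
    and J: "((\<lambda>t. F t * cnj (F t)) has_integral J) {0..2 * pi}" and IJ: "I \<longlonglongrightarrow> J"
    using uniform_limit_integral[OF lim contP] by auto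
  have Ieq: "I N = of_real (2 * pi * (\<Sum>n<N. (cmod (b n))\<^sup>2))" for N
    using has_integral_unique[OF I PI] .
  have "(\<lambda>N. Re (I N) / (2 * pi)) \<longlonglongrightarrow> Re J / (2 * pi)"
    by (intro tendsto_intros IJ) simp
  then have sums: "(\<lambda>n. (cmod (b n))\<^sup>2) sums (Re J / (2 * pi))"
    unfolding sums_def Ieq by simp
  have "((\<lambda>t. Re (F t * cnj (F t)) / (2 * pi)) has_integral (Re J / (2 * pi))) {0..2 * pi}"
    using has_integral_linear[OF J bounded_linear_Re] by (intro has_integral_divide) (simp add: o_def)
  then have "integral {0..2 * pi} (\<lambda>t. (cmod (F t))\<^sup>2 / (2 * pi)) = Re J / (2 * pi)"
    by (intro integral_unique) (simp add: complex_mult_cnj cmod_power2 del: times_complex.sel)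
  \<comment> \<open>\<open>M2\<close> is a square root, and squaring it gives back the integral only
    if that integral is nonnegative.\<close>
  moreover have "0 \<le> Re J / (2 * pi)"
    using sums_le[OF _ sums_zero sums] by simp
  ultimately have "(M2 f r)\<^sup>2 = Re J / (2 * pi)"
    by (simp add: M2_def F_def)
  with sums show ?thesis by (simp add: b_def)
qed

subsection \<open>Moments of random integrals\<close>

text \<open>The tangent at t to the convex function u^s lies below its graph; this is Young's
  inequality with weights 1 / s and 1 - 1 / s.\<close>

lemma young_powr:
  fixes u t s :: real
  assumes "0 \<le> u" "0 < t" "1 \<le> s"
  shows "s * t powr (s - 1) * u \<le> u powr s + (s - 1) * t powr s"
proof (cases "u = 0")
  case False
  then have u: "0 < u" using assms by simp
  have "(u powr s) powr (1 / s) * (t powr s) powr (1 - 1 / s) \<le> 1 / s * u powr s + (1 - 1 / s) * t powr s"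
    using assms u by (intro Youngs_inequality_0) auto
  moreover have "(u powr s) powr (1 / s) = u"
    using assms u by (simp add: powr_powr)
  moreover have "(t powr s) powr (1 - 1 / s) = t powr (s - 1)"
  proof -
    have "s * (1 - 1 / s) = s - 1" using assms by (simp add: field_simps)
    then show ?thesis by (simp only: powr_powr)
  qed
  ultimately have "u * t powr (s - 1) \<le> 1 / s * u powr s + (1 - 1 / s) * t powr s"
    by simp
  then have "s * (u * t powr (s - 1)) \<le> s * (1 / s * u powr s + (1 - 1 / s) * t powr s)"
    using assms by (intro mult_left_mono) auto
  also have "\<dots> = u powr s + (s - 1) * t powr s"
    using assms by (simp add: field_simps)
  finally show ?thesis by (simp add: mult_ac)
qed (use assms in auto)

text \<open>Jensen's inequality for a measure of total mass m, obtained by integrating the tangent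
  inequality taken at the mean t = y / m. The right-hand side may be infinite.\<close>

lemma nn_integral_powr_jensen:
  assumes g [measurable]: "g \<in> borel_measurable N" and g0: "\<And>z. 0 \<le> g z"
    and m: "emeasure N (space N) = ennreal m" "0 < m"
    and y: "(\<integral>\<^sup>+z. ennreal (g z) \<partial>N) = ennreal y" "0 \<le> y" and s: "1 \<le> s"
  shows "ennreal (y powr s) \<le> ennreal (m powr (s - 1)) * (\<integral>\<^sup>+z. ennreal (g z powr s) \<partial>N)"
proof (cases "y = 0")
  case False
  define t where "t = y / m"
  have t: "0 < t" using False y m by (simp add: t_def)
  have y_eq: "y = t * m" using m by (simp add: t_def)
  define I where "I = (\<integral>\<^sup>+z. ennreal (g z powr s) \<partial>N)"
  have "ennreal (s * t powr (s - 1)) * ennreal y = (\<integral>\<^sup>+z. ennreal (s * t powr (s - 1)) * ennreal (g z) \<partial>N)"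
    unfolding y(1)[symmetric] by (intro nn_integral_cmult[symmetric]) measurable
  also have "\<dots> \<le> (\<integral>\<^sup>+z. ennreal (g z powr s) + ennreal ((s - 1) * t powr s) \<partial>N)"
    using young_powr[OF g0 t s] g0 s
    by (intro nn_integral_mono) (auto simp flip: ennreal_mult ennreal_plus intro!: ennreal_leI)
  also have "\<dots> = I + ennreal ((s - 1) * t powr s) * ennreal m"
    unfolding I_def m(1)[symmetric] by (subst nn_integral_add) auto
  finally have *: "ennreal (s * t powr (s - 1)) * ennreal y \<le> I + ennreal ((s - 1) * t powr s) * ennreal m" .
  have "t powr s = t powr (s - 1) * t"
    using t by (simp add: powr_diff)
  then have split: "s * t powr (s - 1) * y = t powr s * m + (s - 1) * t powr s * m"
    by (simp add: y_eq algebra_simps)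
  \<comment> \<open>The summand common to both sides is finite and can be cancelled; what remains on
    the left is t^s * m = y^s / m^(s - 1).\<close>
  have "ennreal (t powr s * m) + ennreal ((s - 1) * t powr s) * ennreal m \<le> I + ennreal ((s - 1) * t powr s) * ennreal m"
    using * s m y split by (simp flip: ennreal_mult ennreal_plus)
  then have "ennreal (t powr s * m) \<le> I"
    by (simp add: ennreal_add_left_cancel_le add.commute[of _ "_ * _"] ennreal_mult_eq_top_iff)
  then have "ennreal (m powr (s - 1)) * ennreal (t powr s * m) \<le> ennreal (m powr (s - 1)) * I"
    by (intro mult_left_mono) auto
  moreover have "y powr s = m powr (s - 1) * (t powr s * m)"
    using t m by (simp add: y_eq powr_mult powr_diff)
  ultimately show ?thesis
    using m by (simp add: I_def flip: ennreal_mult)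
qed simp

text \<open>The abstract form of one Whitney square: N will be the weighted area on the square, R
  the modulus of the random function and V its deterministic size \<open>M2\<close>.\<close>

locale random_integral = prob_space M + N: finite_measure N
  for M :: "'a measure" and N :: "'b measure" +
  fixes R :: "'a \<Rightarrow> 'b \<Rightarrow> real" and V :: "'b \<Rightarrow> real" and p :: real
  assumes measurable_R: "case_prod R \<in> borel_measurable (M \<Otimes>\<^sub>M N)"
    and R_nonneg: "0 \<le> R s z"
    and measurable_V [measurable]: "V \<in> borel_measurable N"
    and V_nonneg: "0 \<le> V z"
    and p_pos: "0 < p"
    and mass_finite: "(\<integral>\<^sup>+z. ennreal (V z powr p) \<partial>N) < \<infinity>"
begin

sublocale pair_sigma_finite M N ..

abbreviation Y :: "'a \<Rightarrow> ennreal" where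
  "Y s \<equiv> \<integral>\<^sup>+z. ennreal (R s z powr p) \<partial>N"

abbreviation mass :: ennreal where
  "mass \<equiv> \<integral>\<^sup>+z. ennreal (V z powr p) \<partial>N"

lemma measurable_R_pair [measurable]: "(\<lambda>x. R (fst x) (snd x)) \<in> borel_measurable (M \<Otimes>\<^sub>M N)"
  using measurable_R by (simp add: case_prod_beta')

lemma measurable_R_section [measurable]: "s \<in> space M \<Longrightarrow> R s \<in> borel_measurable N"
  using measurable_Pair2[OF measurable_R, of s] by simp

lemma measurable_Y [measurable]: "Y \<in> borel_measurable M"
  by (rule N.borel_measurable_nn_integral) (simp add: case_prod_beta')

text \<open>By Tonelli the expectation of Y is at most K p times the mass. For r <= 1 this suffices;
  for r > 1 Jensen's inequality for the measure with density V^p moves the power inside the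
  integral, and the moment of order p * r enters. The constant is the sum of those of both
  cases.\<close>

lemma moment_le:
  assumes moment: "\<And>z t. z \<in> space N \<Longrightarrow> 0 < t \<Longrightarrow>
      (\<integral>\<^sup>+s. ennreal (R s z powr t) \<partial>M) \<le> ennreal (K t * V z powr t)"
    and K: "\<And>t. 0 < t \<Longrightarrow> 0 \<le> K t"
    and zero: "\<And>s z. z \<in> space N \<Longrightarrow> V z = 0 \<Longrightarrow> R s z = 0"
    and r: "0 < r"
  shows "(\<integral>\<^sup>+s. ennreal_powr (Y s) r \<partial>M) \<le> ennreal (1 + K p + K (p * r)) * ennreal_powr mass r"
proof -
  obtain m where m: "0 \<le> m" "mass = ennreal m"
    using mass_finite by (cases mass) auto
  have EY: "(\<integral>\<^sup>+s. Y s \<partial>M) \<le> ennreal (K p * m)"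
  proof -
    have "(\<integral>\<^sup>+s. Y s \<partial>M) = (\<integral>\<^sup>+z. \<integral>\<^sup>+s. ennreal (R s z powr p) \<partial>M \<partial>N)"
      by (intro Fubini'[symmetric]) (simp add: case_prod_beta')
    also have "\<dots> \<le> (\<integral>\<^sup>+z. ennreal (K p) * ennreal (V z powr p) \<partial>N)"
      using moment[OF _ p_pos] K[OF p_pos] by (intro nn_integral_mono) (simp flip: ennreal_mult)
    also have "\<dots> = ennreal (K p * m)"
      using K[OF p_pos] m by (simp add: nn_integral_cmult ennreal_mult)
    finally show ?thesis .
  qed
  show ?thesis
  proof (cases "m = 0")
    case True
    then have "(\<integral>\<^sup>+s. Y s \<partial>M) = 0" using EY by simp
    then have "AE s in M. Y s = 0" by (subst (asm) nn_integral_0_iff_AE) auto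
    then have "(\<integral>\<^sup>+s. ennreal_powr (Y s) r \<partial>M) = (\<integral>\<^sup>+s. 0 \<partial>M)"
      by (intro nn_integral_cong_AE) (auto elim!: eventually_mono)
    then show ?thesis by simp
  next
    case False
    then have m0: "0 < m" using m by simp
    have "(\<integral>\<^sup>+s. ennreal_powr (Y s) r \<partial>M) \<le> ennreal ((1 + K p + K (p * r)) * m powr r)"
    proof (cases "r \<le> 1")
      case True
      \<comment> \<open>Up to m the power is at most m^r; beyond m the factor y^(r - 1) is at most
        m^(r - 1), because r <= 1.\<close>
      have pointwise: "ennreal_powr (Y s) r \<le> ennreal (m powr r) + ennreal (m powr (r - 1)) * Y s" for s
      proof (cases "Y s")
        case (real y)
        have "y powr r \<le> m powr r + m powr (r - 1) * y"
        proof (cases "y \<le> m")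
          case True
          then have "y powr r \<le> m powr r" using real r by (intro powr_mono2) auto
          then show ?thesis using real by (simp add: add_increasing2)
        next
          case False
          then have y: "0 < y" using m0 by linarith
          have "y powr (r - 1) \<le> m powr (r - 1)"
            using \<open>r \<le> 1\<close> False m0 by (intro powr_mono2') auto
          then have "y powr (r - 1) * y \<le> m powr (r - 1) * y"
            using y by (intro mult_right_mono) auto
          moreover have "y powr (r - 1) * y = y powr r" using y by (simp add: powr_diff)
          ultimately show ?thesis by (simp add: add_increasing)
        qed
        then show ?thesis
          using real by (simp flip: ennreal_mult ennreal_plus)
      qed (use m0 in \<open>simp add: ennreal_mult_top\<close>)
      have "(\<integral>\<^sup>+s. ennreal_powr (Y s) r \<partial>M) \<le> (\<integral>\<^sup>+s. ennreal (m powr r) + ennreal (m powr (r - 1)) * Y s \<partial>M)"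
        by (intro nn_integral_mono pointwise)
      also have "\<dots> = ennreal (m powr r) + ennreal (m powr (r - 1)) * (\<integral>\<^sup>+s. Y s \<partial>M)"
        by (simp add: nn_integral_add nn_integral_cmult emeasure_space_1)
      also have "\<dots> \<le> ennreal (m powr r) + ennreal (m powr (r - 1)) * ennreal (K p * m)"
        by (intro add_left_mono mult_left_mono EY) simp
      also have "\<dots> = ennreal (m powr r + m powr (r - 1) * (K p * m))"
        using K[OF p_pos] m0 by (simp flip: ennreal_mult ennreal_plus)
      also have "m powr r + m powr (r - 1) * (K p * m) = (1 + K p) * m powr r"
        using m0 by (simp add: powr_diff algebra_simps)
      also have "ennreal \<dots> \<le> ennreal ((1 + K p + K (p * r)) * m powr r)"
        using K[of "p * r"] p_pos r by (intro ennreal_leI mult_right_mono) auto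
      finally show ?thesis .
    next
      case False
      then have r1: "1 \<le> r" by simp
      define N' where "N' = density N (\<lambda>z. ennreal (V z powr p))"
      define g where "g s z = R s z powr p / V z powr p" for s z
      have g0: "0 \<le> g s z" for s z by (simp add: g_def)
      have gm: "g s \<in> borel_measurable N'" if "s \<in> space M" for s
        unfolding g_def[abs_def] N'_def using that by measurable
      have mN': "emeasure N' (space N') = ennreal m"
        unfolding N'_def m(2)[symmetric] by (simp add: emeasure_density)
      \<comment> \<open>Where V vanishes, g is 0 by the convention for division by 0, and the
        hypothesis \<open>zero\<close> makes R vanish as well.\<close>
      have gV: "g s z * V z powr p = R s z powr p" if "z \<in> space N" for s z
        using zero[OF that, of s] by (auto simp: g_def)
      have gY: "(\<integral>\<^sup>+z. ennreal (g s z) \<partial>N') = Y s" if "s \<in> space M" for s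
        unfolding N'_def using that gV
        by (subst nn_integral_density)
          (auto simp: g_def[abs_def] mult.commute ennreal_mult[symmetric] intro!: nn_integral_cong)
      define H where "H s = (\<integral>\<^sup>+z. ennreal (g s z powr r) * ennreal (V z powr p) \<partial>N)" for s
      have finY: "AE s in M. Y s \<noteq> \<infinity>"
        using EY by (intro nn_integral_PInf_AE) (auto simp: top_unique)
      have Hm: "H \<in> borel_measurable M"
        unfolding H_def[abs_def] g_def
        by (rule N.borel_measurable_nn_integral) (simp add: case_prod_beta')
      have "(\<integral>\<^sup>+s. ennreal_powr (Y s) r \<partial>M) \<le> (\<integral>\<^sup>+s. ennreal (m powr (r - 1)) * H s \<partial>M)"
      proof (rule nn_integral_mono_AE)
        show "AE s in M. ennreal_powr (Y s) r \<le> ennreal (m powr (r - 1)) * H s"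
          using finY AE_space
        proof eventually_elim
          case (elim s)
          then obtain y where y: "0 \<le> y" "Y s = ennreal y" by (cases "Y s") auto
          have "ennreal (y powr r) \<le> ennreal (m powr (r - 1)) * (\<integral>\<^sup>+z. ennreal (g s z powr r) \<partial>N')"
            using gY[of s] elim y by (intro nn_integral_powr_jensen gm g0 mN' m0 r1) auto
          also have "(\<integral>\<^sup>+z. ennreal (g s z powr r) \<partial>N') = H s"
            unfolding N'_def H_def g_def[abs_def] using elim
            by (subst nn_integral_density) (auto simp: mult.commute)
          finally show ?case using y by simp
        qed
      qed
      also have "\<dots> = ennreal (m powr (r - 1)) * (\<integral>\<^sup>+s. H s \<partial>M)"
        using Hm by (rule nn_integral_cmult)
      also have "(\<integral>\<^sup>+s. H s \<partial>M) = (\<integral>\<^sup>+z. \<integral>\<^sup>+s. ennreal (g s z powr r) * ennreal (V z powr p) \<partial>M \<partial>N)"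
        unfolding H_def g_def by (intro Fubini'[symmetric]) (simp add: case_prod_beta')
      also have "\<dots> \<le> (\<integral>\<^sup>+z. ennreal (K (p * r)) * ennreal (V z powr p) \<partial>N)"
      proof (intro nn_integral_mono)
        fix z assume z: "z \<in> space N"
        then have [measurable]: "(\<lambda>s. R s z) \<in> borel_measurable M"
          using measurable_Pair1[OF measurable_R, of z] by simp
        show "(\<integral>\<^sup>+s. ennreal (g s z powr r) * ennreal (V z powr p) \<partial>M) \<le> ennreal (K (p * r)) * ennreal (V z powr p)"
        proof (cases "V z = 0")
          case False
          then have v: "0 < V z" using V_nonneg[of z] by simp
          have "(\<integral>\<^sup>+s. ennreal (g s z powr r) * ennreal (V z powr p) \<partial>M) =
              (\<integral>\<^sup>+s. ennreal (V z powr p / V z powr (p * r)) * ennreal (R s z powr (p * r)) \<partial>M)"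
            using v R_nonneg by (intro nn_integral_cong)
              (simp add: g_def powr_divide powr_powr mult_ac flip: ennreal_mult)
          also have "\<dots> = ennreal (V z powr p / V z powr (p * r)) * (\<integral>\<^sup>+s. ennreal (R s z powr (p * r)) \<partial>M)"
            by (intro nn_integral_cmult) measurable
          also have "\<dots> \<le> ennreal (V z powr p / V z powr (p * r)) * ennreal (K (p * r) * V z powr (p * r))"
            using moment[OF z, of "p * r"] p_pos r by (intro mult_left_mono) auto
          also have "\<dots> = ennreal (K (p * r)) * ennreal (V z powr p)"
            using v K[of "p * r"] p_pos r by (simp flip: ennreal_mult)
          finally show ?thesis .
        qed (use p_pos in simp)
      qed
      also have "\<dots> = ennreal (K (p * r)) * ennreal m"
        using m by (simp add: nn_integral_cmult)
      finally have "(\<integral>\<^sup>+s. ennreal_powr (Y s) r \<partial>M) \<le> ennreal (m powr (r - 1)) * (ennreal (K (p * r)) * ennreal m)"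
        by (simp add: mult_left_mono)
      also have "\<dots> = ennreal (K (p * r) * m powr r)"
        using m0 K[of "p * r"] p_pos r by (simp add: powr_diff mult_ac flip: ennreal_mult)
      also have "\<dots> \<le> ennreal ((1 + K p + K (p * r)) * m powr r)"
        using K[OF p_pos] by (intro ennreal_leI mult_right_mono) auto
      finally show ?thesis .
    qed
    also have "\<dots> = ennreal (1 + K p + K (p * r)) * ennreal_powr mass r"
      using m K[OF p_pos] K[of "p * r"] p_pos r by (simp add: ennreal_mult)
    finally show ?thesis .
  qed
qed

text \<open>The integral of a minimum is at most the minimum of the integrals, so Tonelli gives min
  (Y, mass) an expectation of at least k * mass. Its quotient x by the mass lies in [0, 1] and has
  mean at least k; \<open>min_one_le_min_powr\<close> with e = k / 2 then bounds the mean of x^r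
  below by (k / 2)^(1 + r).\<close>

lemma truncated_moment_ge:
  assumes lower: "\<And>z. z \<in> space N \<Longrightarrow>
      ennreal (k * V z powr p) \<le> (\<integral>\<^sup>+s. ennreal (min (R s z powr p) (V z powr p)) \<partial>M)"
    and k: "0 < k" "k \<le> 1" and r: "0 < r"
  shows "ennreal ((k / 2) powr (1 + r)) * ennreal_powr mass r \<le>
    (\<integral>\<^sup>+s. min (ennreal_powr (Y s) r) (ennreal_powr mass r) \<partial>M)"
proof -
  obtain m where m: "0 \<le> m" "mass = ennreal m"
    using mass_finite by (cases mass) auto
  have min_ge: "ennreal (k * m) \<le> (\<integral>\<^sup>+s. min (Y s) mass \<partial>M)"
  proof -
    have "ennreal (k * m) = (\<integral>\<^sup>+z. ennreal k * ennreal (V z powr p) \<partial>N)"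
      using m k by (simp add: nn_integral_cmult ennreal_mult)
    also have "\<dots> \<le> (\<integral>\<^sup>+z. \<integral>\<^sup>+s. ennreal (min (R s z powr p) (V z powr p)) \<partial>M \<partial>N)"
      using lower k by (intro nn_integral_mono) (simp flip: ennreal_mult)
    also have "\<dots> = (\<integral>\<^sup>+s. \<integral>\<^sup>+z. ennreal (min (R s z powr p) (V z powr p)) \<partial>N \<partial>M)"
      by (intro Fubini') (simp add: case_prod_beta')
    also have "\<dots> \<le> (\<integral>\<^sup>+s. min (Y s) mass \<partial>M)"
      by (intro nn_integral_mono min.boundedI) (auto intro!: nn_integral_mono ennreal_leI)
    finally show ?thesis .
  qed
  show ?thesis
  proof (cases "m = 0")
    case False
    then have m0: "0 < m" using m by simp
    define x where "x s = enn2real (min (Y s) mass) / m" for s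
    have [measurable]: "x \<in> borel_measurable M" unfolding x_def[abs_def] by measurable
    have fin: "min (Y s) mass < \<top>" for s using mass_finite by (simp add: min_less_iff_disj)
    have x_eq: "min (Y s) mass = ennreal (m * x s)" for s
      using m0 fin[of s] by (simp add: x_def)
    have x: "0 \<le> x s" "x s \<le> 1" for s
    proof -
      show "0 \<le> x s" using m0 by (simp add: x_def)
      have "ennreal (m * x s) \<le> ennreal m"
        unfolding x_eq[symmetric] m(2)[symmetric] by simp
      then show "x s \<le> 1" using m0 by (simp add: mult_le_cancel_left1)
    qed
    have powr_eq: "min (ennreal_powr (Y s) r) (ennreal_powr mass r) = ennreal (m powr r) * ennreal (x s powr r)" for s
    proof -
      have "min (ennreal_powr (Y s) r) (ennreal_powr mass r) = ennreal_powr (min (Y s) mass) r"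
        using ennreal_powr_mono[of "Y s" mass r] ennreal_powr_mono[of mass "Y s" r] r
        by (cases "Y s \<le> mass") (auto simp: min_def)
      also have "\<dots> = ennreal (m powr r) * ennreal (x s powr r)"
        unfolding x_eq using m0 x[of s] by (simp add: powr_mult flip: ennreal_mult)
      finally show ?thesis .
    qed
    define e where "e = k / 2"
    have e: "0 < e" "e \<le> 1" using k by (auto simp: e_def)
    define I where "I = (\<integral>\<^sup>+s. ennreal (x s powr r) \<partial>M)"
    have "I \<le> (\<integral>\<^sup>+s. 1 \<partial>M)"
      unfolding I_def using x r by (intro nn_integral_mono) (simp add: powr_le1)
    then obtain i where i: "0 \<le> i" "I = ennreal i"
      by (cases I) (auto simp: emeasure_space_1 top_unique)
    have pointwise: "m * x s \<le> m * e + m / e powr r * x s powr r" for s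
    proof -
      have "x s \<le> e + x s powr r / e powr r"
        using min_one_le_min_powr[OF x(1)[of s] e r] x[of s] r by (simp add: powr_le1 min_absorb1)
      then have "m * x s \<le> m * (e + x s powr r / e powr r)"
        using m0 by (intro mult_left_mono) auto
      then show ?thesis by (simp add: algebra_simps)
    qed
    have "ennreal (k * m) \<le> (\<integral>\<^sup>+s. ennreal (m * e) + ennreal (m / e powr r) * ennreal (x s powr r) \<partial>M)"
      using min_ge unfolding x_eq
      by (rule order_trans[OF _ nn_integral_mono])
        (use pointwise m0 e in \<open>simp flip: ennreal_mult ennreal_plus\<close>)
    also have "\<dots> = ennreal (m * e) + ennreal (m / e powr r) * I"
      unfolding I_def by (simp add: nn_integral_add nn_integral_cmult emeasure_space_1)
    also have "\<dots> = ennreal (m * e + m / e powr r * i)"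
      unfolding i(2) using m0 e i(1) by (simp flip: ennreal_mult ennreal_plus)
    finally have "k * m \<le> m * e + m / e powr r * i"
      using m0 e i by (subst (asm) ennreal_le_iff) auto
    moreover have "k * m = 2 * (m * e)" by (simp add: e_def)
    ultimately have "m * e \<le> m / e powr r * i" by linarith
    then have "e * e powr r \<le> i"
      using m0 e by (simp add: field_simps)
    then have "e powr (1 + r) \<le> i" using e by (simp add: powr_add)
    then have "ennreal (e powr (1 + r)) * ennreal (m powr r) \<le> ennreal (m powr r) * I"
      unfolding i(2) by (subst mult.commute) (intro mult_left_mono ennreal_leI; simp)
    also have "\<dots> = (\<integral>\<^sup>+s. min (ennreal_powr (Y s) r) (ennreal_powr mass r) \<partial>M)"
      unfolding powr_eq I_def by (intro nn_integral_cmult[symmetric]) measurable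
    finally show ?thesis using m by (simp add: e_def)
  qed (use m in simp)
qed

end

section \<open>Almost sure finiteness of random sums over a countable family\<close>

lemma measurable_infsum_ennreal:
  fixes Y :: "'q \<Rightarrow> 'a \<Rightarrow> ennreal"
  assumes W: "countable W" and Y: "\<And>Q. Q \<in> W \<Longrightarrow> Y Q \<in> borel_measurable M"
  shows "(\<lambda>s. \<Sum>\<^sub>\<infinity>Q\<in>W. Y Q s) \<in> borel_measurable M"
proof -
  interpret C: sigma_finite_measure "count_space W"
    using W by (rule sigma_finite_measure_count_space_countable)
  have "(\<lambda>x. Y (snd x) (fst x)) \<in> borel_measurable (M \<Otimes>\<^sub>M count_space W)"
    by (rule measurable_compose_countable'[OF _ _ W, where f="\<lambda>Q x. Y Q (fst x)" and g=snd])
      (auto intro: measurable_compose[OF measurable_fst Y])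
  then show ?thesis
    unfolding infsum_eq_nn_integral_count_space[OF W]
    by (intro C.borel_measurable_nn_integral) (simp add: case_prod_beta')
qed

context prob_space
begin

text \<open>The events T > n decrease to the null event on which T is infinite, so their
  probabilities tend to 0.\<close>

lemma ennreal_tail_small:
  assumes [measurable]: "T \<in> borel_measurable M" and fin: "AE s in M. T s < (\<infinity>::ennreal)" and "0 < d"
  obtains B :: nat where "emeasure M {s \<in> space M. of_nat B < T s} \<le> ennreal d"
proof -
  define A where "A n = {s \<in> space M. of_nat n < T s}" for n
  have A [measurable]: "A n \<in> sets M" for n unfolding A_def by measurable
  have "decseq A"
    unfolding A_def decseq_def by (auto intro: order_le_less_trans[rotated])
  then have "(\<lambda>n. measure M (A n)) \<longlonglongrightarrow> measure M (\<Inter>n. A n)"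
    using A by (intro finite_Lim_measure_decseq) auto
  moreover have "measure M (\<Inter>n. A n) = 0"
  proof -
    have "AE s in M. s \<notin> (\<Inter>n. A n)"
      using fin
    proof eventually_elim
      case (elim s)
      then obtain n :: nat where "T s \<le> of_nat n"
        by (metis ennreal_Ex_less_of_nat less_imp_le infinity_ennreal_def)
      then show ?case by (auto simp: A_def not_less)
    qed
    then show ?thesis
      using A by (subst prob_eq_0) auto
  qed
  ultimately have "eventually (\<lambda>n. measure M (A n) < d) sequentially"
    using \<open>0 < d\<close> by (intro order_tendstoD) auto
  then obtain n where "measure M (A n) < d" by (auto simp: eventually_sequentially)
  then have "emeasure M (A n) \<le> ennreal d"
    by (simp add: emeasure_eq_measure ennreal_leI)
  then show ?thesis using that by (simp add: A_def)
qed

text \<open>The truncation at m Q is essential: on the exceptional event the minimum is at most m Q,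
  so one event of probability at most c / 2, common to all Q, costs at most half of each lower
  bound.\<close>

lemma sum_finite_of_AE_finite:
  fixes m :: "'q \<Rightarrow> ennreal"
  assumes W: "countable W" and Y: "\<And>Q. Q \<in> W \<Longrightarrow> Y Q \<in> borel_measurable M"
    and m: "\<And>Q. Q \<in> W \<Longrightarrow> m Q < \<infinity>" and c: "0 < c"
    and lower: "\<And>Q. Q \<in> W \<Longrightarrow> ennreal c * m Q \<le> (\<integral>\<^sup>+s. min (Y Q s) (m Q) \<partial>M)"
    and fin: "AE s in M. (\<Sum>\<^sub>\<infinity>Q\<in>W. Y Q s) < \<infinity>"
  shows "(\<Sum>\<^sub>\<infinity>Q\<in>W. m Q) < \<infinity>"
proof -
  define T where "T s = (\<Sum>\<^sub>\<infinity>Q\<in>W. Y Q s)" for s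
  have T_eq: "T s = (\<integral>\<^sup>+Q. Y Q s \<partial>count_space W)" for s
    unfolding T_def using W by (rule infsum_eq_nn_integral_count_space)
  have Tm [measurable]: "T \<in> borel_measurable M"
    unfolding T_def using W Y by (rule measurable_infsum_ennreal)
  obtain B :: nat where B: "emeasure M {s \<in> space M. of_nat B < T s} \<le> ennreal (c / 2)"
    using ennreal_tail_small[OF Tm, of "c / 2"] fin c unfolding T_def by auto
  define A where "A = {s \<in> space M. T s \<le> of_nat B}"
  have A [measurable]: "A \<in> sets M" unfolding A_def by measurable
  have part: "ennreal (c / 2) * m Q \<le> (\<integral>\<^sup>+s. Y Q s * indicator A s \<partial>M)" if Q: "Q \<in> W" for Q
  proof -
    note [measurable] = Y[OF Q]
    have "ennreal c * m Q \<le> (\<integral>\<^sup>+s. Y Q s * indicator A s + m Q * indicator (space M - A) s \<partial>M)"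
      using lower[OF Q]
      by (rule order_trans) (auto intro!: nn_integral_mono simp: min_le_iff_disj split: split_indicator)
    also have "\<dots> = (\<integral>\<^sup>+s. Y Q s * indicator A s \<partial>M) + m Q * emeasure M (space M - A)"
      by (simp add: nn_integral_add nn_integral_cmult_indicator)
    also have "space M - A = {s \<in> space M. of_nat B < T s}"
      by (auto simp: A_def)
    also have "m Q * emeasure M \<dots> \<le> m Q * ennreal (c / 2)"
      by (intro mult_left_mono B) simp
    finally have "ennreal c * m Q \<le> (\<integral>\<^sup>+s. Y Q s * indicator A s \<partial>M) + m Q * ennreal (c / 2)"
      by (simp add: add_left_mono)
    moreover have "ennreal c * m Q = ennreal (c / 2) * m Q + m Q * ennreal (c / 2)"
      using c by (simp add: mult.commute[of "m Q"] flip: distrib_right ennreal_plus)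
    ultimately have "m Q * ennreal (c / 2) + ennreal (c / 2) * m Q \<le>
        m Q * ennreal (c / 2) + (\<integral>\<^sup>+s. Y Q s * indicator A s \<partial>M)"
      by (simp only: add.commute)
    \<comment> \<open>Subtracting this term from both sides is legitimate because m Q is
      finite.\<close>
    moreover have "m Q * ennreal (c / 2) \<noteq> \<top>"
      using m[OF Q] by (simp add: ennreal_mult_eq_top_iff)
    ultimately show ?thesis
      by (simp only: ennreal_add_left_cancel_le infinity_ennreal_def simp_thms)
  qed
  have "ennreal (c / 2) * (\<Sum>\<^sub>\<infinity>Q\<in>W. m Q) = (\<integral>\<^sup>+Q. ennreal (c / 2) * m Q \<partial>count_space W)"
    using W by (simp add: infsum_eq_nn_integral_count_space nn_integral_cmult)
  also have "\<dots> \<le> (\<integral>\<^sup>+Q. \<integral>\<^sup>+s. Y Q s * indicator A s \<partial>M \<partial>count_space W)"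
    using part by (intro nn_integral_mono) simp
  also have "\<dots> = (\<integral>\<^sup>+s. \<integral>\<^sup>+Q. Y Q s * indicator A s \<partial>count_space W \<partial>M)"
    using Y W by (intro nn_integral_count_space_nn_integral[symmetric]) auto
  also have "\<dots> \<le> (\<integral>\<^sup>+s. of_nat B \<partial>M)"
    by (intro nn_integral_mono) (auto simp: T_eq A_def nn_integral_multc split: split_indicator)
  also have "\<dots> < \<infinity>" by (simp add: emeasure_space_1 of_nat_less_top)
  finally show ?thesis
    using c by (auto simp: ennreal_mult_less_top)
qed

end

subsection \<open>Random Taylor series\<close>

text \<open>Holds for arbitrary f, since a non-integrable integrand has integral 0 by
  convention.\<close>

lemma M2_nonneg: "0 \<le> M2 f r"
  unfolding M2_def
proof (rule real_sqrt_ge_zero)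
  let ?g = "\<lambda>t. (cmod (f (of_real r * cis t)))\<^sup>2 / (2 * pi)"
  show "0 \<le> integral {0..2 * pi} ?g"
  proof (cases "?g integrable_on {0..2 * pi}")
    case True
    then show ?thesis by (rule Henstock_Kurzweil_Integration.integral_nonneg) simp
  next
    case False
    then have "integral {0..2 * pi} ?g = 0" by (rule not_integrable_integral)
    then show ?thesis by (simp only: order_refl)
  qed
qed

lemma standard_random_sequence_subgaussian:
  assumes "standard_random_sequence M X"
  shows "normalized_subgaussian_sequence M X"
proof -
  obtain \<mu> where ps: "prob_space M" and ind: "prob_space.indep_vars M (\<lambda>_. borel) X UNIV"
    and mu: "\<mu> \<in> {bernoulli_law, steinhaus_law, gaussian_law}" and law: "\<And>n. distr M borel (X n) = \<mu>"
    using assms unfolding standard_random_sequence_def by blast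
  interpret prob_space M by (rule ps)
  have sub: "normalized_subgaussian_law \<mu>"
    using mu normalized_subgaussian_bernoulli normalized_subgaussian_steinhaus
      normalized_subgaussian_gaussian by auto
  have [measurable]: "X n \<in> borel_measurable M" for n
    using ind unfolding indep_vars_def by simp
  show ?thesis
  proof
    show "indep_vars (\<lambda>_. borel) X UNIV" by (rule ind)
    fix n
    note sub' = sub[unfolded law[of n, symmetric] normalized_subgaussian_law_def]
    show "integrable M (X n)" "expectation (X n) = 0"
      "integrable M (\<lambda>s. (cmod (X n s))\<^sup>2)" "expectation (\<lambda>s. (cmod (X n s))\<^sup>2) = 1"
      using sub' by (simp_all add: integrable_distr_eq integral_distr)
    show "(\<integral>\<^sup>+s. ennreal (exp (Re (c * X n s))) \<partial>M) \<le> ennreal (exp ((cmod c)\<^sup>2 / 2))" for c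
      using sub' by (simp add: nn_integral_distr del: times_complex.sel)
  qed
qed

context normalized_subgaussian_sequence
begin

text \<open>On each circle of radius r < 1 the Taylor series converges absolutely, and E |X n| <= 2
  preserves this in the mean, hence almost surely. Countably many radii tending to 1 give a single
  null set valid for all z in the disk.\<close>

lemma AE_summable_powser:
  assumes f: "f holomorphic_on unit_disk"
  shows "AE s in M. \<forall>z\<in>unit_disk. summable (\<lambda>n. taylor_coeff f n * X n s * z ^ n)"
proof -
  have norm_X: "(\<integral>\<^sup>+s. ennreal (cmod (X n s)) \<partial>M) \<le> 2" for n
  proof -
    \<comment> \<open>This turns the second moment 1 into the bound 2 for the first absolute
      moment.\<close>
    have "x \<le> 1 + x\<^sup>2" for x :: real
      using zero_le_power2[of "x - 1 / 2"] by (simp add: power2_diff field_simps power2_eq_square)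
    then have "(\<integral>\<^sup>+s. ennreal (cmod (X n s)) \<partial>M) \<le> (\<integral>\<^sup>+s. ennreal 1 + ennreal ((cmod (X n s))\<^sup>2) \<partial>M)"
      by (intro nn_integral_mono) (simp add: ennreal_leI flip: ennreal_plus ennreal_1)
    also have "\<dots> = 1 + (\<integral>\<^sup>+s. ennreal ((cmod (X n s))\<^sup>2) \<partial>M)"
      by (simp add: nn_integral_add emeasure_space_1)
    also have "(\<integral>\<^sup>+s. ennreal ((cmod (X n s))\<^sup>2) \<partial>M) = ennreal 1"
      using integrable_norm_X_sq expectation_norm_X_sq by (subst nn_integral_eq_integral) auto
    finally show ?thesis by simp
  qed
  define \<rho> :: "nat \<Rightarrow> real" where "\<rho> k = 1 - 1 / real (k + 2)" for k
  have \<rho>: "0 \<le> \<rho> k" "\<rho> k < 1" for k by (auto simp: \<rho>_def)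
  have "AE s in M. summable (\<lambda>n. cmod (taylor_coeff f n * X n s * of_real (\<rho> k) ^ n))" for k
  proof -
    define b where "b n = cmod (taylor_coeff f n * of_real (\<rho> k) ^ n)" for n
    have b: "summable b" "\<And>n. 0 \<le> b n"
      unfolding b_def using taylor_coeff_summable_norm[OF f, of "of_real (\<rho> k)"] \<rho>[of k] by auto
    have "(\<integral>\<^sup>+s. (\<Sum>n. ennreal (b n) * ennreal (cmod (X n s))) \<partial>M) =
        (\<Sum>n. ennreal (b n) * (\<integral>\<^sup>+s. ennreal (cmod (X n s)) \<partial>M))"
      by (simp add: nn_integral_suminf nn_integral_cmult)
    also have "\<dots> \<le> (\<Sum>n. ennreal (b n) * 2)"
      using norm_X by (intro suminf_le mult_left_mono) auto
    also have "\<dots> = ennreal (\<Sum>n. b n) * 2"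
      using b by (simp add: ennreal_suminf_multc suminf_ennreal2)
    also have "\<dots> < \<infinity>" by (simp add: ennreal_mult_less_top)
    finally have "AE s in M. (\<Sum>n. ennreal (b n) * ennreal (cmod (X n s))) \<noteq> \<infinity>"
      by (intro nn_integral_PInf_AE) (auto simp: less_top)
    then show ?thesis
    proof eventually_elim
      case (elim s)
      have "ennreal (cmod (taylor_coeff f n * X n s * of_real (\<rho> k) ^ n)) = ennreal (b n) * ennreal (cmod (X n s))" for n
        by (subst ennreal_mult[symmetric]) (simp_all add: b_def norm_mult mult_ac)
      then have "(\<Sum>n. ennreal (cmod (taylor_coeff f n * X n s * of_real (\<rho> k) ^ n))) \<noteq> \<top>"
        using elim by simp
      then show ?case by (intro summable_suminf_not_top) auto
    qed
  qed
  then have "AE s in M. \<forall>k. summable (\<lambda>n. cmod (taylor_coeff f n * X n s * of_real (\<rho> k) ^ n))"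
    by (simp add: AE_all_countable)
  then show ?thesis
  proof eventually_elim
    case (elim s)
    show ?case
    proof
      fix z assume "z \<in> unit_disk"
      then have "0 < 1 - cmod z" by simp
      then obtain k where "inverse (real (Suc k)) < 1 - cmod z"
        using reals_Archimedean by blast
      moreover have "1 / real (k + 2) \<le> inverse (real (Suc k))"
        by (simp add: field_simps)
      ultimately have k: "cmod z \<le> \<rho> k" by (simp add: \<rho>_def)
      show "summable (\<lambda>n. taylor_coeff f n * X n s * z ^ n)"
      proof (rule summable_comparison_test'[OF elim[rule_format, of k], of 0])
        fix n
        show "cmod (taylor_coeff f n * X n s * z ^ n) \<le> cmod (taylor_coeff f n * X n s * of_real (\<rho> k) ^ n)"
          using k \<rho>[of k] by (simp add: norm_mult norm_power power_mono mult_left_mono)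
      qed
    qed
  qed
qed

lemma AE_randomize_holomorphic:
  assumes f: "f holomorphic_on unit_disk"
  shows "AE s in M. randomize (\<lambda>n. X n s) f holomorphic_on unit_disk"
  using AE_summable_powser[OF f]
proof eventually_elim
  case (elim s)
  show ?case
  proof (rule power_series_holomorphic)
    fix z :: complex assume "z \<in> unit_disk"
    then show "(\<lambda>n. taylor_coeff f n * X n s * (z - 0) ^ n) sums randomize (\<lambda>n. X n s) f z"
      using elim by (simp add: randomize_def summable_sums)
  qed
qed

text \<open>The bounds for random series apply to the coefficients a_n z^n, whose square sum is
  M2(f, |z|)^2 by Parseval. The third clause holds for every s, as \<open>moment_le\<close>
  requires, because then all terms of the series vanish.\<close>

lemma randomize_moments:
  assumes f: "f holomorphic_on unit_disk" and z: "z \<in> unit_disk"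
  shows "0 < t \<Longrightarrow> (\<integral>\<^sup>+s. ennreal (cmod (randomize (\<lambda>n. X n s) f z) powr t) \<partial>M)
      \<le> ennreal (8 * (2 * t) powr t * M2 f (cmod z) powr t)"
    and "0 < t \<Longrightarrow> ennreal (kappa t * M2 f (cmod z) powr t) \<le>
      (\<integral>\<^sup>+s. ennreal (min (cmod (randomize (\<lambda>n. X n s) f z) powr t) (M2 f (cmod z) powr t)) \<partial>M)"
    and "M2 f (cmod z) = 0 \<Longrightarrow> randomize (\<lambda>n. X n s) f z = 0"
proof -
  define c where "c n = taylor_coeff f n * z ^ n" for n
  have sums: "(\<lambda>n. (cmod (c n))\<^sup>2) sums (M2 f (cmod z))\<^sup>2"
    using parseval_M2[OF f, of "cmod z"] z by (simp add: c_def norm_mult norm_power)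
  have rand: "randomize (\<lambda>n. X n s) f z = (\<Sum>n. c n * X n s)" for s
    by (simp add: randomize_def c_def mult_ac)
  have conv: "AE s in M. summable (\<lambda>n. c n * X n s)"
    using AE_summable_powser[OF f]
  proof eventually_elim
    case (elim s)
    then show ?case using z by (simp add: c_def mult_ac)
  qed
  show "0 < t \<Longrightarrow> (\<integral>\<^sup>+s. ennreal (cmod (randomize (\<lambda>n. X n s) f z) powr t) \<partial>M)
      \<le> ennreal (8 * (2 * t) powr t * M2 f (cmod z) powr t)"
    unfolding rand by (rule moment_suminf_le[OF M2_nonneg sums _ conv])
  show "0 < t \<Longrightarrow> ennreal (kappa t * M2 f (cmod z) powr t) \<le>
      (\<integral>\<^sup>+s. ennreal (min (cmod (randomize (\<lambda>n. X n s) f z) powr t) (M2 f (cmod z) powr t)) \<partial>M)"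
    unfolding rand by (rule truncated_moment_suminf_ge[OF M2_nonneg sums _ conv])
  assume "M2 f (cmod z) = 0"
  then have "c n = 0" for n
    using sums suminf_eq_zero_iff[of "\<lambda>n. (cmod (c n))\<^sup>2"] by (auto simp: sums_iff)
  then show "randomize (\<lambda>n. X n s) f z = 0" by (simp add: rand)
qed

end

section \<open>Monotonicity and measurability of the square means\<close>

lemma M2_mono:
  assumes f: "f holomorphic_on unit_disk" and "0 \<le> r" "r \<le> r'" "r' < 1"
  shows "M2 f r \<le> M2 f r'"
proof -
  have "(M2 f r)\<^sup>2 \<le> (M2 f r')\<^sup>2"
  proof (rule sums_le[OF _ parseval_M2[OF f] parseval_M2[OF f]])
    show "(cmod (taylor_coeff f n * of_real r ^ n))\<^sup>2 \<le> (cmod (taylor_coeff f n * of_real r' ^ n))\<^sup>2" for n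
      using assms by (intro power_mono) (auto simp: norm_mult norm_power intro!: mult_left_mono power_mono)
  qed (use assms in auto)
  then show ?thesis by (rule power2_le_imp_le) (rule M2_nonneg)
qed

lemma borel_imp_area_measurable: "g \<in> borel_measurable borel \<Longrightarrow> g \<in> borel_measurable area"
  by (subst measurable_cong_sets[OF sets_area refl])
    (intro measurable_restrict_space1 measurable_completion; simp)

text \<open>Parseval's identity replaces the parameter integral by the square root of a series of
  Borel functions of |z|.\<close>

lemma measurable_M2_cmod:
  assumes f: "f holomorphic_on unit_disk"
  shows "(\<lambda>z. M2 f (cmod z)) \<in> borel_measurable area"
proof -
  have "(\<lambda>z. sqrt (\<Sum>n. (cmod (taylor_coeff f n * of_real (cmod z) ^ n))\<^sup>2)) \<in> borel_measurable area"
    by (rule borel_imp_area_measurable) measurable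
  moreover have "M2 f (cmod z) = sqrt (\<Sum>n. (cmod (taylor_coeff f n * of_real (cmod z) ^ n))\<^sup>2)"
    if "z \<in> space area" for z
    using sums_unique[OF parseval_M2[OF f, of "cmod z"]] that
    by (intro real_sqrt_unique[symmetric] M2_nonneg) auto
  ultimately show ?thesis
    by (subst measurable_cong) auto
qed

subsection \<open>The theorem\<close>

lemma nn_integral_density_indicator:
  assumes "w \<in> borel_measurable area" "Q \<in> sets area" "g \<in> borel_measurable area"
    and "\<And>z. 0 \<le> g z"
  shows "(\<integral>\<^sup>+z. ennreal (g z) \<partial>density area (\<lambda>z. ennreal (w z) * indicator Q z)) =
    (\<integral>\<^sup>+z\<in>Q. ennreal (g z * w z) \<partial>area)"
  using assms by (subst nn_integral_density) (auto intro!: nn_integral_cong simp: ennreal_mult' mult_ac)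

text \<open>The last assumption keeps Q inside a smaller disk; together with the finite mass of w it
  makes the integral of \<open>M2\<close> to the power p over Q finite.\<close>

locale random_tent = normalized_subgaussian_sequence M X for M :: "'a measure" and X +
  fixes p :: real and w :: "complex \<Rightarrow> real" and f :: "complex \<Rightarrow> complex" and Q :: "complex set"
  assumes p_pos: "0 < p" and w_meas: "w \<in> borel_measurable (lebesgue_on unit_disk)"
    and w_mass: "(\<integral>\<^sup>+z. ennreal (w z) \<partial>area) < \<infinity>"
    and f_holo: "f holomorphic_on unit_disk" and Q_meas: "Q \<in> sets area"
    and Q_dist: "0 < setdist Q (sphere 0 1)"
begin

abbreviation N :: "complex measure" where
  "N \<equiv> density area (\<lambda>z. ennreal (w z) * indicator Q z)"

lemma w_meas_area [measurable]: "w \<in> borel_measurable area"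
  using w_meas by (subst measurable_cong_sets[OF sets_area refl])

lemma finite_measure_N: "finite_measure N"
proof
  have "emeasure N (space N) = (\<integral>\<^sup>+z. ennreal (w z) * indicator Q z \<partial>area)"
    using Q_meas sets.top[of area] by (subst emeasure_density) (auto intro!: nn_integral_cong)
  also have "\<dots> \<le> (\<integral>\<^sup>+z. ennreal (w z) \<partial>area)"
    by (intro nn_integral_mono) (auto split: split_indicator)
  finally show "emeasure N (space N) \<noteq> \<infinity>" using w_mass by (auto simp: top_unique)
qed

lemma measurable_randomize:
  "(\<lambda>x. randomize (\<lambda>n. X n (fst x)) f (snd x)) \<in> borel_measurable (M \<Otimes>\<^sub>M N)"
proof -
  have [measurable]: "(\<lambda>z. z) \<in> borel_measurable N"
    using borel_imp_area_measurable[of "\<lambda>z. z"] by simp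
  have [measurable]: "snd \<in> borel_measurable (M \<Otimes>\<^sub>M N)"
    using measurable_compose[OF measurable_snd \<open>(\<lambda>z. z) \<in> borel_measurable N\<close>] by simp
  show ?thesis unfolding randomize_def by measurable
qed

sublocale random_integral M N "\<lambda>s z. cmod (randomize (\<lambda>n. X n s) f z)" "\<lambda>z. M2 f (cmod z)" p
proof -
  interpret N: finite_measure N by (rule finite_measure_N)
  have V: "(\<lambda>z. M2 f (cmod z)) \<in> borel_measurable N"
    using measurable_M2_cmod[OF f_holo] by simp
  \<comment> \<open>Every point of Q has modulus at most d < 1, so by monotonicity
    \<open>M2 f d\<close> bounds the integrand on Q.\<close>
  define d where "d = 1 - setdist Q (sphere 0 1)"
  have le: "M2 f (cmod z) \<le> M2 f d" if "z \<in> Q" "z \<in> unit_disk" for z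
  proof (rule M2_mono[OF f_holo])
    show "cmod z \<le> d" using setdist_sphere_le[of z Q] that by (simp add: d_def)
  qed (use Q_dist in \<open>auto simp: d_def\<close>)
  have "AE z in N. z \<in> Q"
    using Q_meas by (subst AE_density) (auto split: split_indicator_asm)
  then have "AE z in N. ennreal (M2 f (cmod z) powr p) \<le> ennreal (M2 f d powr p)"
    using AE_space
  proof eventually_elim
    case (elim z)
    then show ?case using p_pos by (intro ennreal_leI powr_mono2 M2_nonneg le) auto
  qed
  then have "(\<integral>\<^sup>+z. ennreal (M2 f (cmod z) powr p) \<partial>N) \<le> (\<integral>\<^sup>+z. ennreal (M2 f d powr p) \<partial>N)"
    by (rule nn_integral_mono_AE)
  also have "\<dots> < \<infinity>"
  proof -
    have "emeasure N (space N) < \<infinity>"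
      using N.emeasure_finite[of "space N"] by (simp only: less_top infinity_ennreal_def)
    then show ?thesis by (simp add: ennreal_mult_less_top)
  qed
  finally have fin: "(\<integral>\<^sup>+z. ennreal (M2 f (cmod z) powr p) \<partial>N) < \<infinity>" .
  show "random_integral M N (\<lambda>s z. cmod (randomize (\<lambda>n. X n s) f z)) (\<lambda>z. M2 f (cmod z)) p"
    by unfold_locales
      (use measurable_randomize V fin p_pos M2_nonneg in \<open>auto simp: case_prod_beta'\<close>)
qed

lemma Y_eq:
  assumes "s \<in> space M"
  shows "Y s = (\<integral>\<^sup>+z\<in>Q. ennreal (cmod (randomize (\<lambda>n. X n s) f z) powr p * w z) \<partial>area)"
proof (rule nn_integral_density_indicator)
  show "(\<lambda>z. cmod (randomize (\<lambda>n. X n s) f z) powr p) \<in> borel_measurable area"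
    using measurable_R_section[OF assms] by simp
qed (use Q_meas in auto)

lemma mass_eq: "mass = (\<integral>\<^sup>+z\<in>Q. ennreal (M2 f (cmod z) powr p * w z) \<partial>area)"
  using measurable_M2_cmod[OF f_holo] Q_meas by (intro nn_integral_density_indicator) auto

lemma tent_moment_le:
  assumes "0 < r"
  shows "(\<integral>\<^sup>+s. ennreal_powr (Y s) r \<partial>M) \<le>
    ennreal (1 + 8 * (2 * p) powr p + 8 * (2 * (p * r)) powr (p * r)) * ennreal_powr mass r"
  by (rule moment_le[where K="\<lambda>t. 8 * (2 * t) powr t"])
    (use assms randomize_moments[OF f_holo] in auto)

lemma tent_truncated_moment_ge:
  assumes "0 < r"
  shows "ennreal ((kappa p / 2) powr (1 + r)) * ennreal_powr mass r \<le>
    (\<integral>\<^sup>+s. min (ennreal_powr (Y s) r) (ennreal_powr mass r) \<partial>M)"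
proof (rule truncated_moment_ge)
  have "(1 / 262144 :: real) powr (p / 2) \<le> 1"
    using p_pos by (intro powr_le1) auto
  then show "kappa p \<le> 1" by (simp add: kappa_def)
qed (use assms kappa_pos randomize_moments[OF f_holo] p_pos in auto)

end

theorem theorem1p12:
  fixes p q :: real
    and w :: "complex \<Rightarrow> real"
    and M :: "'a measure"
    and X :: "nat \<Rightarrow> 'a \<Rightarrow> complex"
    and W :: "complex set set"
    and f :: "complex \<Rightarrow> complex"
  assumes "0 < p" and "0 < q"
    and "admissible_weight p w"
    and "standard_random_sequence M X"
    and "whitney_decomposition W"
    and "f holomorphic_on unit_disk"
  shows "(AE s in M. randomize (\<lambda>n. X n s) f \<in> analytic_tent_space p q w) \<longleftrightarrow>
    (\<Sum>\<^sub>\<infinity>Q\<in>W. ennreal_powr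
       (\<integral>\<^sup>+z\<in>Q. ennreal (M2 f (cmod z) powr p * w z) \<partial>area) (q / p)) < \<infinity>"
proof -
  interpret normalized_subgaussian_sequence M X
    using assms(4) by (rule standard_random_sequence_subgaussian)
  have w: "w \<in> borel_measurable (lebesgue_on unit_disk)" "(\<integral>\<^sup>+z. ennreal (w z) \<partial>area) < \<infinity>"
    using assms(3) by (auto simp: admissible_weight_def weight_def)
  have W: "countable W"
    using assms(5) by (simp add: whitney_decomposition_def)
  have r: "0 < q / p" using assms by simp
  have tent: "random_tent M X p w f Q" if "Q \<in> W" for Q
    using assms w that whitney_decomposition_measurable whitney_decomposition_setdist_pos
    by unfold_locales auto
  define y where "y Q s = ennreal_powr
    (\<integral>\<^sup>+z\<in>Q. ennreal (cmod (randomize (\<lambda>n. X n s) f z) powr p * w z) \<partial>area) (q / p)" for Q s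
  define m where "m Q = ennreal_powr
    (\<integral>\<^sup>+z\<in>Q. ennreal (M2 f (cmod z) powr p * w z) \<partial>area) (q / p)" for Q
  have y_meas: "y Q \<in> borel_measurable M" if Q: "Q \<in> W" for Q
  proof -
    interpret random_tent M X p w f Q by (rule tent[OF Q])
    have "(\<lambda>s. ennreal_powr (Y s) (q / p)) \<in> borel_measurable M" by measurable
    then show ?thesis
      using Y_eq by (subst measurable_cong[where g="\<lambda>s. ennreal_powr (Y s) (q / p)"]) (auto simp: y_def)
  qed
  have rand_meas: "randomize (\<lambda>n. X n s) f \<in> borel_measurable (lebesgue_on unit_disk)"
    if "randomize (\<lambda>n. X n s) f holomorphic_on unit_disk" for s
    using holomorphic_on_imp_continuous_on[OF that]
    by (intro continuous_imp_measurable_on_sets_lebesgue) auto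
  \<comment> \<open>A comparison for individual realisations: whenever the random function is
    holomorphic, the decomposition found by the tent space condition can be exchanged for the given
    W. What remains concerns one fixed family of random variables.\<close>
  have "(AE s in M. randomize (\<lambda>n. X n s) f \<in> analytic_tent_space p q w) \<longleftrightarrow>
      (AE s in M. (\<Sum>\<^sub>\<infinity>Q\<in>W. y Q s) < \<infinity>)"
  proof (rule eventually_cong[OF AE_randomize_holomorphic[OF assms(6)]])
    fix s assume holo: "randomize (\<lambda>n. X n s) f holomorphic_on unit_disk"
    note rand_meas[OF holo, measurable]
    have h: "(\<lambda>z. ennreal (cmod (randomize (\<lambda>n. X n s) f z) powr p * w z)) \<in> borel_measurable (lebesgue_on unit_disk)"
      using w by measurable
    show "randomize (\<lambda>n. X n s) f \<in> analytic_tent_space p q w \<longleftrightarrow> (\<Sum>\<^sub>\<infinity>Q\<in>W. y Q s) < \<infinity>"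
    proof
      assume "randomize (\<lambda>n. X n s) f \<in> analytic_tent_space p q w"
      then obtain W' where "whitney_decomposition W'"
        "(\<Sum>\<^sub>\<infinity>Q\<in>W'. ennreal_powr
          (\<integral>\<^sup>+z\<in>Q. ennreal (cmod (randomize (\<lambda>n. X n s) f z) powr p * w z) \<partial>area) (q / p)) < \<infinity>"
        unfolding analytic_tent_space_def tent_space_def by blast
      then show "(\<Sum>\<^sub>\<infinity>Q\<in>W. y Q s) < \<infinity>"
        unfolding y_def by (intro whitney_sum_finite_transfer[OF _ assms(5) h r])
    next
      assume "(\<Sum>\<^sub>\<infinity>Q\<in>W. y Q s) < \<infinity>"
      then show "randomize (\<lambda>n. X n s) f \<in> analytic_tent_space p q w"
        unfolding y_def analytic_tent_space_def tent_space_def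
        using holo rand_meas[OF holo] assms(5) by blast
    qed
  qed
  also have "\<dots> \<longleftrightarrow> (\<Sum>\<^sub>\<infinity>Q\<in>W. m Q) < \<infinity>"
  proof
    assume "AE s in M. (\<Sum>\<^sub>\<infinity>Q\<in>W. y Q s) < \<infinity>"
    then show "(\<Sum>\<^sub>\<infinity>Q\<in>W. m Q) < \<infinity>"
    proof (rule sum_finite_of_AE_finite[OF W y_meas, rotated -1])
      show "0 < (kappa p / 2) powr (1 + q / p)" using kappa_pos[of p] by simp
      fix Q assume Q: "Q \<in> W"
      interpret random_tent M X p w f Q by (rule tent[OF Q])
      have m_eq: "m Q = ennreal_powr mass (q / p)" by (simp add: m_def mass_eq)
      show "m Q < \<infinity>"
        using mass_finite unfolding m_eq by (simp add: ennreal_powr_def less_top)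
      have "(\<integral>\<^sup>+s. min (y Q s) (m Q) \<partial>M) =
          (\<integral>\<^sup>+s. min (ennreal_powr (Y s) (q / p)) (ennreal_powr mass (q / p)) \<partial>M)"
        unfolding m_eq using Y_eq by (intro nn_integral_cong) (simp add: y_def)
      then show "ennreal ((kappa p / 2) powr (1 + q / p)) * m Q \<le> (\<integral>\<^sup>+s. min (y Q s) (m Q) \<partial>M)"
        using tent_truncated_moment_ge[OF r] by (simp add: m_eq)
    qed
  next
    assume fin: "(\<Sum>\<^sub>\<infinity>Q\<in>W. m Q) < \<infinity>"
    \<comment> \<open>The constant of \<open>tent_moment_le\<close> for r = q / p. It is the same
      for all squares, so Tonelli bounds the expectation of the whole random sum by C times the
      deterministic one.\<close>
    define C where "C = 1 + 8 * (2 * p) powr p + 8 * (2 * (p * (q / p))) powr (p * (q / p))"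
    have "(\<integral>\<^sup>+s. (\<Sum>\<^sub>\<infinity>Q\<in>W. y Q s) \<partial>M) = (\<integral>\<^sup>+Q. \<integral>\<^sup>+s. y Q s \<partial>M \<partial>count_space W)"
      unfolding infsum_eq_nn_integral_count_space[OF W]
      using W y_meas by (rule nn_integral_count_space_nn_integral)
    also have "\<dots> \<le> (\<integral>\<^sup>+Q. ennreal C * m Q \<partial>count_space W)"
    proof (intro nn_integral_mono)
      fix Q assume "Q \<in> space (count_space W)"
      then have Q: "Q \<in> W" by simp
      interpret random_tent M X p w f Q by (rule tent[OF Q])
      have "(\<integral>\<^sup>+s. y Q s \<partial>M) = (\<integral>\<^sup>+s. ennreal_powr (Y s) (q / p) \<partial>M)"
        using Y_eq by (intro nn_integral_cong) (simp add: y_def)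
      then show "(\<integral>\<^sup>+s. y Q s \<partial>M) \<le> ennreal C * m Q"
        using tent_moment_le[OF r] by (simp add: m_def mass_eq C_def)
    qed
    also have "\<dots> = ennreal C * (\<Sum>\<^sub>\<infinity>Q\<in>W. m Q)"
      using W by (simp add: infsum_eq_nn_integral_count_space nn_integral_cmult)
    also have "\<dots> < \<infinity>" using fin by (simp add: ennreal_mult_less_top)
    finally have "(\<integral>\<^sup>+s. (\<Sum>\<^sub>\<infinity>Q\<in>W. y Q s) \<partial>M) \<noteq> \<infinity>" by simp
    moreover have "(\<lambda>s. \<Sum>\<^sub>\<infinity>Q\<in>W. y Q s) \<in> borel_measurable M"
      using W y_meas by (rule measurable_infsum_ennreal)
    ultimately show "AE s in M. (\<Sum>\<^sub>\<infinity>Q\<in>W. y Q s) < \<infinity>"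
      using nn_integral_PInf_AE by (auto simp: less_top)
  qed
  finally show ?thesis by (simp add: m_def)
qed

end
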